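(* Let $\gamma_2>0$, $0<8\delta<2l-n$, $2\gamma_1=2l-n-8\delta$, $\gamma=\min\{\gamma_1,\gamma_2\}$. There are $\hat c=\hat c(V)$ and $k_0=k_0(V,\gamma_2,\delta)$ such that for $k>k_0$, $t\in\chi_q(k,\delta)$ and every $A\in\mathbb C$ with $|\sigma||A|^2<k^{-\gamma_2}$, the sequence $\{W_m^+\}_{m=0}^\infty$ converges to a continuous and periodic potential $W^+$ with respect to the norm $\|\cdot\|_*$, and $$\|W^+-W_m^+\|_*<2(\hat c k^{-\gamma})^{m+1}.$$
   Context: Setting. $l,n$ are fixed positive integers with $2l>n$; $\sigma\in\mathbb R$; $Q=[0,2\pi]^n$; $K=[0,1)^n$. $V(x)=\sum_{m\in\mathbb Z^n,\,0<|m|\le R_0}v_me^{i\langle m,x\rangle}$ is a real-valued trigonometric polynomial, not identically zero, and $q\in\mathbb Z^n\setminus\{0\}$ is fixed with $v_q\neq0$. For a $2\pi$-periodic $W$ with Fourier coefficients $w_m$, $\|W\|_*=\sum_{m}|w_m|$. For $j\in\mathbb Z^n$: $P_j(t)=j+t$, $p_j(t)=|P_j(t)|$. $H_0(t)$ is $(-\Delta)^l$ in $L^2(Q)$ with the quasi-periodic conditions $\partial_{x_s}^ru(x_1,\dots,x_s+2\pi,\dots,x_n)=e^{2\pi i t_s}\partial_{x_s}^ru(x)$, $s=1,\dots,n$, $r=0,\dots,2l-1$. Operators are written as matrices in the basis $e^{i\langle P_s(t),x\rangle}$, $s\in\mathbb Z^n$: $H_0(t)=\mathrm{diag}(p_s^{2l}(t))$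 and multiplication by $W$ is $(w_{s-r})_{s,r}$. Resonant set. $S(k)$ is the sphere of radius $k$ centered at $0$, $S_q(k,n-2+\delta)=\{x\in S(k):\big||x|^2-|x-q|^2\big|<4k^{-n+2-\delta}\}$, and $\mathcal K:\mathbb R^n\to K$, $\mathcal KP_m(t)=t$. $\chi_q(k,\delta)$ is a subset of $\mathcal KS_q(k,n-2+\delta)$ such that for each $t\in\chi_q(k,\delta)$: there is $j\in\mathbb Z^n$ with $P_j(t)\in S_q(k,n-2+\delta)$; $|p_{j-q}^2(t)-p_j^2(t)|<4k^{-n+2-\delta}$; and $\min_{i\ne j,j-q}|p_j^2(t)-p_i^2(t)|>2k^{-n+2-6\delta}$. It has asymptotically full measure in $\mathcal KS_q(k,n-2+\delta)$ (relative measure of the complement $O(k^{-\delta/2})$). For $t$ near $\chi_q(k,\delta)$, $j$ is the index attached to a nearby point of $\chi_q(k,\delta)$. For $t$ in the $(2k^{-n+1-7\delta})$-neighborhood of $\chi_q(k,\delta)$ and $z$ on the circle $C_1^+=\{z:|z-\hat\lambda^+(t)|=d\}$, $d=\frac1{10}|v_q|$, one has $2|p_m^{2l}(t)-z|\ge k^{2l-n-6\delta}$ for $m\neq j,j-q$. Model operator. $\hat\lambda^\pm(t)=a\pm b$, $2a=p_j^{2l}+p_{j-q}^{2l}$, $2b=(4|v_q|^2+(p_j^{2l}-p_{j-q}^{2l})^2)^{1/2}$, are the eigenvalues of $\begin{pmatrix}p_j^{2l}(t)&v_q\\ v_{-q}&p_{j-q}^{2l}(t)\end{pmatrix}$. $P_q$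 is the diagonal projection onto coordinates $j,j-q$, $\hat H_q(t)=H_0(t)+P_qVP_q$, and $\hat E^+(t)$ is the rank-one spectral projection of $\hat H_q(t)$ for $\hat\lambda^+(t)$ (supported on coordinates $j,j-q$). Construction. For periodic $W$ with $\|W\|_*<\infty$ put $Y=W-P_qVP_q$ and (whenever the series converges) $\hat E^+_W=\hat E^++\sum_{r\ge1}\hat G^+_{W,r}$, where $\hat G^+_{W,r}=\frac{(-1)^{r+1}}{2\pi i}\oint_{C_1^+}((\hat H_q-z)^{-1}Y)^r(\hat H_q-z)^{-1}dz$. For $A\in\mathbb C$ put $u_W^+(x)=A\sum_{s}(\hat E_W^+)_{sj}e^{i\langle P_s(t),x\rangle}$, $\hat{\mathcal M}^+W=V+\sigma|u_W^+|^2$, $W_0^+=V$, $W_m^+=\hat{\mathcal M}^+W_{m-1}^+$. *)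

theory Defs
  imports "HOL-Complex_Analysis.Complex_Analysis" "HOL-Library.Landau_Symbols"
begin

text \<open>The lattice of integer points is the type \<^typ>\<open>int ^ 'n\<close>; the dimension is \<open>CARD('n)\<close>.\<close>

definition lat :: "int ^ 'n \<Rightarrow> real ^ 'n" where
  "lat m = (\<chi> s. real_of_int (m $ s))"

definition periodic :: "(real ^ 'n \<Rightarrow> real) \<Rightarrow> bool" where
  "periodic W \<longleftrightarrow> (\<forall>x s. W (x + (2 * pi) *\<^sub>R axis s 1) = W x)"

definition fourier_coeff :: "(real ^ 'n \<Rightarrow> real) \<Rightarrow> int ^ 'n \<Rightarrow> complex" where
  "fourier_coeff W m =
     (LINT x:cbox 0 (\<chi> s. 2 * pi)|lborel. complex_of_real (W x) * cis (- (lat m \<bullet> x)))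
       / (2 * pi) ^ CARD('n)"

text \<open>The norm takes values in \<^typ>\<open>ennreal\<close>, so that it is \<open>\<infinity>\<close> when the Fourier
  coefficients are not absolutely summable.\<close>

definition star_norm :: "(real ^ 'n \<Rightarrow> real) \<Rightarrow> ennreal" where
  "star_norm W = (\<Sum>\<^sub>\<infinity>m. ennreal (cmod (fourier_coeff W m)))"

text \<open>Periodic \<open>W\<close> with finite norm; integrability over a period cell is what gives the
  Fourier coefficients their meaning.\<close>

definition star_potential :: "(real ^ 'n \<Rightarrow> real) \<Rightarrow> bool" where
  "star_potential W \<longleftrightarrow>
     periodic W \<and> set_integrable lborel (cbox 0 (\<chi> s. 2 * pi)) W \<and> star_norm W < \<infinity>"

text \<open>\<open>V(x) = \<Sum> v\<^sub>m exp(i\<langle>m,x\<rangle>)\<close> over \<open>0 < |m| \<le> R\<^sub>0\<close>, where the \<open>v\<^sub>m\<close> are written as the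
  Fourier coefficients of \<open>V\<close>.\<close>

definition trig_polynomial :: "real \<Rightarrow> (real ^ 'n \<Rightarrow> real) \<Rightarrow> bool" where
  "trig_polynomial R0 V \<longleftrightarrow>
     (\<forall>x. complex_of_real (V x) =
        (\<Sum>m | 0 < norm (lat m) \<and> norm (lat m) \<le> R0. fourier_coeff V m * cis (lat m \<bullet> x)))"

definition P :: "int ^ 'n \<Rightarrow> real ^ 'n \<Rightarrow> real ^ 'n" where
  "P m t = lat m + t"

definition p :: "int ^ 'n \<Rightarrow> real ^ 'n \<Rightarrow> real" where
  "p m t = norm (P m t)"

text \<open>The map written \<open>\<K>\<close> in the literature, onto the cell \<open>[0,1)\<^sup>n\<close>.\<close>

definition cell_map :: "real ^ 'n \<Rightarrow> real ^ 'n" where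
  "cell_map x = (\<chi> s. frac (x $ s))"

text \<open>This is \<open>S\<^sub>q(k, n - 2 + \<delta>)\<close>; the shifted exponent is built into the definition.\<close>

definition resonant_sphere :: "int ^ 'n \<Rightarrow> real \<Rightarrow> real \<Rightarrow> (real ^ 'n) set" where
  "resonant_sphere q k \<delta> =
     {x \<in> sphere 0 k. \<bar>(norm x)\<^sup>2 - (norm (x - lat q))\<^sup>2\<bar>
                         < 4 * k powr (- real CARD('n) + 2 - \<delta>)}"

definition resonant_index ::
  "int ^ 'n \<Rightarrow> real \<Rightarrow> real \<Rightarrow> real ^ 'n \<Rightarrow> int ^ 'n \<Rightarrow> bool" where
  "resonant_index q k \<delta> t j \<longleftrightarrow>
     P j t \<in> resonant_sphere q k \<delta> \<and>
     \<bar>(p (j - q) t)\<^sup>2 - (p j t)\<^sup>2\<bar> < 4 * k powr (- real CARD('n) + 2 - \<delta>) \<and>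
     (\<forall>i. i \<noteq> j \<and> i \<noteq> j - q \<longrightarrow>
        \<bar>(p j t)\<^sup>2 - (p i t)\<^sup>2\<bar> > 2 * k powr (- real CARD('n) + 2 - 6 * \<delta>))"

definition lambda_plus ::
  "nat \<Rightarrow> (real ^ 'n \<Rightarrow> real) \<Rightarrow> int ^ 'n \<Rightarrow> int ^ 'n \<Rightarrow> real ^ 'n \<Rightarrow> real" where
  "lambda_plus l V q j t =
     (p j t ^ (2 * l) + p (j - q) t ^ (2 * l)) / 2 +
     sqrt (4 * (cmod (fourier_coeff V q))\<^sup>2 + (p j t ^ (2 * l) - p (j - q) t ^ (2 * l))\<^sup>2) / 2"

definition contour_radius :: "(real ^ 'n \<Rightarrow> real) \<Rightarrow> int ^ 'n \<Rightarrow> real" where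
  "contour_radius V q = cmod (fourier_coeff V q) / 10"

text \<open>For \<open>B\<close> contained in the sphere of radius \<open>k\<close> about the origin, the Lebesgue measure of
  \<open>cone_over B\<close> is \<open>k/n\<close> times the surface measure of \<open>B\<close>. Hence quotients of such measures
  are relative surface measures.\<close>

definition cone_over :: "(real ^ 'n) set \<Rightarrow> (real ^ 'n) set" where
  "cone_over B = {r *\<^sub>R x | r x. 0 < r \<and> r \<le> 1 \<and> x \<in> B}"

definition nonresonant_part ::
  "int ^ 'n \<Rightarrow> (real \<Rightarrow> real \<Rightarrow> (real ^ 'n) set) \<Rightarrow> real \<Rightarrow> real \<Rightarrow> (real ^ 'n) set" where
  "nonresonant_part q X k \<delta> = {x \<in> resonant_sphere q k \<delta>. cell_map x \<notin> X k \<delta>}"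

text \<open>The properties of the sets \<open>\<chi>\<^sub>q(k, \<delta>)\<close>, written \<open>X k \<delta>\<close> here because \<open>\<chi>\<close> is vector
  notation. The last clause of the first conjunct is the bound on the contour. The relative
  measure is taken upstairs on the sphere, through the preimage of \<open>X k \<delta>\<close> under the cell map.\<close>

definition resonant_family ::
  "nat \<Rightarrow> (real ^ 'n \<Rightarrow> real) \<Rightarrow> int ^ 'n \<Rightarrow> (real \<Rightarrow> real \<Rightarrow> (real ^ 'n) set) \<Rightarrow> bool" where
  "resonant_family l V q X \<longleftrightarrow>
     (\<forall>\<delta>. 0 < 8 * \<delta> \<and> 8 * \<delta> < 2 * real l - real CARD('n) \<longrightarrow>
        (\<forall>\<^sub>F k in at_top.
           X k \<delta> \<subseteq> cell_map ` resonant_sphere q k \<delta> \<and>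
           (\<forall>t\<in>X k \<delta>. \<exists>j. resonant_index q k \<delta> t j) \<and>
           (\<forall>t0\<in>X k \<delta>. \<forall>j. resonant_index q k \<delta> t0 j \<longrightarrow>
              (\<forall>t. dist t t0 < 2 * k powr (- real CARD('n) + 1 - 7 * \<delta>) \<longrightarrow>
                (\<forall>z\<in>sphere (complex_of_real (lambda_plus l V q j t)) (contour_radius V q).
                  \<forall>m. m \<noteq> j \<and> m \<noteq> j - q \<longrightarrow>
                    2 * cmod (complex_of_real (p m t ^ (2 * l)) - z)
                      \<ge> k powr (2 * real l - real CARD('n) - 6 * \<delta>))))) \<and>
        (\<forall>\<^sub>F k in at_top. cone_over (nonresonant_part q X k \<delta>) \<in> sets lebesgue) \<and>
        (\<lambda>k. measure lebesgue (cone_over (nonresonant_part q X k \<delta>))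
              / measure lebesgue (cone_over (resonant_sphere q k \<delta>)))
          \<in> O[at_top](\<lambda>k. k powr (- \<delta> / 2)))"

type_synonym 'n lmat = "int ^ 'n \<Rightarrow> int ^ 'n \<Rightarrow> complex"

definition mmult :: "'n lmat \<Rightarrow> 'n lmat \<Rightarrow> 'n lmat" (infixl \<open>\<odot>\<close> 70) where
  "(M \<odot> N) a b = (\<Sum>\<^sub>\<infinity>c. M a c * N c b)"

definition mone :: "'n lmat" where
  "mone a b = (if a = b then 1 else 0)"

text \<open>Only applied to \<open>H_hat\<close> below. That matrix is block diagonal with blocks of size at
  most two, so that a two-sided matrix inverse of \<open>H - z\<close> is unique and is the matrix of the
  resolvent whenever the latter exists.\<close>

definition resolvent :: "'n lmat \<Rightarrow> complex \<Rightarrow> 'n lmat" where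
  "resolvent H z = (THE R. (\<lambda>a b. H a b - z * mone a b) \<odot> R = mone \<and>
                           R \<odot> (\<lambda>a b. H a b - z * mone a b) = mone)"

definition H0 :: "nat \<Rightarrow> real ^ 'n \<Rightarrow> 'n lmat" where
  "H0 l t a b = (if a = b then complex_of_real (p a t ^ (2 * l)) else 0)"

definition mult_op :: "(real ^ 'n \<Rightarrow> real) \<Rightarrow> 'n lmat" where
  "mult_op W a b = fourier_coeff W (a - b)"

definition Pq :: "int ^ 'n \<Rightarrow> int ^ 'n \<Rightarrow> 'n lmat" where
  "Pq q j a b = (if a = b \<and> a \<in> {j, j - q} then 1 else 0)"

definition H_hat ::
  "nat \<Rightarrow> (real ^ 'n \<Rightarrow> real) \<Rightarrow> int ^ 'n \<Rightarrow> int ^ 'n \<Rightarrow> real ^ 'n \<Rightarrow> 'n lmat" where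
  "H_hat l V q j t a b = H0 l t a b + (Pq q j \<odot> mult_op V \<odot> Pq q j) a b"

text \<open>\<open>e\<close> is a unit eigenvector supported on \<open>j\<close>, \<open>j - q\<close>. It is unique up to a phase, since the
  eigenvalues of the block are distinct for \<open>v\<^sub>q \<noteq> 0\<close>.\<close>

definition E_hat ::
  "nat \<Rightarrow> (real ^ 'n \<Rightarrow> real) \<Rightarrow> int ^ 'n \<Rightarrow> int ^ 'n \<Rightarrow> real ^ 'n \<Rightarrow> 'n lmat" where
  "E_hat l V q j t = (THE E. \<exists>e.
     (\<forall>a. a \<notin> {j, j - q} \<longrightarrow> e a = 0) \<and>
     (\<Sum>a\<in>{j, j - q}. (cmod (e a))\<^sup>2) = 1 \<and>
     (\<forall>a. (\<Sum>\<^sub>\<infinity>b. H_hat l V q j t a b * e b) = complex_of_real (lambda_plus l V q j t) * e a) \<and>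
     E = (\<lambda>a b. e a * cnj (e b)))"

definition Y_op ::
  "(real ^ 'n \<Rightarrow> real) \<Rightarrow> int ^ 'n \<Rightarrow> int ^ 'n \<Rightarrow> (real ^ 'n \<Rightarrow> real) \<Rightarrow> 'n lmat" where
  "Y_op V q j W a b = mult_op W a b - (Pq q j \<odot> mult_op V \<odot> Pq q j) a b"

definition G_hat ::
  "nat \<Rightarrow> (real ^ 'n \<Rightarrow> real) \<Rightarrow> int ^ 'n \<Rightarrow> int ^ 'n \<Rightarrow> real ^ 'n \<Rightarrow> (real ^ 'n \<Rightarrow> real)
     \<Rightarrow> nat \<Rightarrow> 'n lmat" where
  "G_hat l V q j t W r a b =
     (- 1) ^ (r + 1) / (2 * complex_of_real pi * \<i>) *
     contour_integral
       (circlepath (complex_of_real (lambda_plus l V q j t)) (contour_radius V q))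
       (\<lambda>z. let R = resolvent (H_hat l V q j t) z
            in (((\<odot>) (R \<odot> Y_op V q j W) ^^ r) R) a b)"

definition E_pert ::
  "nat \<Rightarrow> (real ^ 'n \<Rightarrow> real) \<Rightarrow> int ^ 'n \<Rightarrow> int ^ 'n \<Rightarrow> real ^ 'n \<Rightarrow> (real ^ 'n \<Rightarrow> real)
     \<Rightarrow> 'n lmat" where
  "E_pert l V q j t W a b =
     E_hat l V q j t a b + (\<Sum>r. G_hat l V q j t W (Suc r) a b)"

text \<open>The construction of \<open>u\<close> from \<open>W\<close> makes sense: the series for the projection converges and
  its \<open>j\<close>-th column, i.e. the Fourier series of \<open>u\<close>, is absolutely summable.\<close>

definition expansion_converges ::
  "nat \<Rightarrow> (real ^ 'n \<Rightarrow> real) \<Rightarrow> int ^ 'n \<Rightarrow> int ^ 'n \<Rightarrow> real ^ 'n \<Rightarrow> (real ^ 'n \<Rightarrow> real)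
     \<Rightarrow> bool" where
  "expansion_converges l V q j t W \<longleftrightarrow>
     (\<forall>a b. summable (\<lambda>r. G_hat l V q j t W (Suc r) a b)) \<and>
     (\<lambda>s. cmod (E_pert l V q j t W s j)) summable_on UNIV"

definition u_plus ::
  "nat \<Rightarrow> (real ^ 'n \<Rightarrow> real) \<Rightarrow> int ^ 'n \<Rightarrow> int ^ 'n \<Rightarrow> real ^ 'n \<Rightarrow> complex
     \<Rightarrow> (real ^ 'n \<Rightarrow> real) \<Rightarrow> real ^ 'n \<Rightarrow> complex" where
  "u_plus l V q j t A W x =
     A * (\<Sum>\<^sub>\<infinity>s. E_pert l V q j t W s j * cis (P s t \<bullet> x))"

definition M_plus ::
  "nat \<Rightarrow> (real ^ 'n \<Rightarrow> real) \<Rightarrow> int ^ 'n \<Rightarrow> int ^ 'n \<Rightarrow> real ^ 'n \<Rightarrow> real \<Rightarrow> complex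
     \<Rightarrow> (real ^ 'n \<Rightarrow> real) \<Rightarrow> real ^ 'n \<Rightarrow> real" where
  "M_plus l V q j t \<sigma> A W x = V x + \<sigma> * (cmod (u_plus l V q j t A W x))\<^sup>2"

definition W_plus ::
  "nat \<Rightarrow> (real ^ 'n \<Rightarrow> real) \<Rightarrow> int ^ 'n \<Rightarrow> int ^ 'n \<Rightarrow> real ^ 'n \<Rightarrow> real \<Rightarrow> complex
     \<Rightarrow> nat \<Rightarrow> real ^ 'n \<Rightarrow> real" where
  "W_plus l V q j t \<sigma> A m = (M_plus l V q j t \<sigma> A ^^ m) V"

end

theory Submission
  imports Defs
begin

text \<open>Give the coordinates \<open>j\<close> and \<open>j - q\<close> weight \<open>1\<close> and all others weight \<open>\<tau> = k powr (- \<gamma>)\<close>, and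
  let \<open>S\<close> be the diagonal matrix of weights. On the contour the resolvent is \<open>S R' S\<close> with \<open>R'\<close>
  bounded independently of \<open>k\<close>, since off the resonant block it is \<open>O(\<tau>\<^sup>2)\<close>. The block of \<open>Y\<close> only contains
  \<open>W - V\<close>, so that \<open>S Y S\<close> has column sums of size \<open>\<tau> * \<parallel>V\<parallel> + \<parallel>W - V\<parallel>\<close>. Hence the perturbation
  series is geometric with ratio \<open>O(\<tau>)\<close> and the projection is Lipschitz in \<open>W\<close> with a constant
  depending only on \<open>V\<close>. Since the coefficients of \<open>|u|\<^sup>2\<close> are the autocorrelation of those
  of \<open>u\<close>, the map \<open>W \<mapsto> V + \<sigma>|u|\<^sup>2\<close> has Lipschitz constant \<open>O(\<tau>)\<close>, and the first step has size
  \<open>O(\<tau>)\<close> as well.\<close>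

subsection \<open>Absolutely summable families\<close>

text \<open>The obstacle is that the resolvent does not decay on the two resonant coordinates: there
  it stays of size \<open>1/|v_q|\<close> for every \<open>k\<close>, while \<open>Y\<close> couples
  these coordinates to the others with strength \<open>\<parallel>V\<parallel>\<close>. A product of
  resolvent and \<open>Y\<close> therefore need not be small in the unweighted norm; a power of
  \<open>k\<close> is gained only on passing through a nonresonant coordinate. The weights hand half
  of that gain to each of the two neighbouring factors \<open>Y\<close>, which is why the exponent
  of the gap is halved in \<open>\<gamma>1\<close>. All other constants come from the circle, whose
  radius is fixed by \<open>v_q\<close>, so none of them grows with \<open>k\<close>. Column sums
  are the operator norm on l1, the norm that matches \<open>star_norm\<close>: only column
  \<open>j\<close> of the projection enters \<open>u\<close>, and l1 is closed under
  autocorrelation. The iteration is carried out on coefficient sequences in a ball of radius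
  O(\<tau>) about those of \<open>V\<close>. The limit is taken there and summed to a function only
  afterwards, so that continuity comes from absolute summability.\<close>

definition l1_bounded :: "('a \<Rightarrow> 'b::real_normed_vector) \<Rightarrow> real \<Rightarrow> bool" where
  "l1_bounded f C \<longleftrightarrow> (\<forall>F. finite F \<longrightarrow> (\<Sum>a\<in>F. norm (f a)) \<le> C)"

lemma l1_boundedI: "(\<And>F. finite F \<Longrightarrow> (\<Sum>a\<in>F. norm (f a)) \<le> C) \<Longrightarrow> l1_bounded f C"
  by (simp add: l1_bounded_def)

lemma l1_boundedD: "l1_bounded f C \<Longrightarrow> finite F \<Longrightarrow> (\<Sum>a\<in>F. norm (f a)) \<le> C"
  by (simp add: l1_bounded_def)

lemma l1_bounded_nonneg: "l1_bounded f C \<Longrightarrow> 0 \<le> C"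
  using l1_boundedD[of f C "{}"] by simp

lemma l1_bounded_norm_le: "l1_bounded f C \<Longrightarrow> norm (f a) \<le> C"
  using l1_boundedD[of f C "{a}"] by simp

lemma l1_bounded_summable: "l1_bounded f C \<Longrightarrow> (\<lambda>a. norm (f a)) summable_on UNIV"
  by (rule nonneg_bdd_above_summable_on) (auto intro!: bdd_aboveI2[where M = C] l1_boundedD)

lemma l1_bounded_infsum_le: "l1_bounded f C \<Longrightarrow> (\<Sum>\<^sub>\<infinity>a. norm (f a)) \<le> C"
  by (rule infsum_le_finite_sums[OF l1_bounded_summable]) (auto intro: l1_boundedD)

lemma l1_bounded_iff:
  "l1_bounded f C \<longleftrightarrow> (\<lambda>a. norm (f a)) summable_on UNIV \<and> (\<Sum>\<^sub>\<infinity>a. norm (f a)) \<le> C"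
proof
  assume *: "(\<lambda>a. norm (f a)) summable_on UNIV \<and> (\<Sum>\<^sub>\<infinity>a. norm (f a)) \<le> C"
  show "l1_bounded f C"
  proof (rule l1_boundedI)
    fix F :: "'a set" assume "finite F"
    then have "(\<Sum>a\<in>F. norm (f a)) \<le> (\<Sum>\<^sub>\<infinity>a. norm (f a))"
      using * by (intro finite_sum_le_infsum) auto
    then show "(\<Sum>a\<in>F. norm (f a)) \<le> C" using * by simp
  qed
qed (auto intro: l1_bounded_summable l1_bounded_infsum_le)

lemma l1_bounded_mono:
  assumes "l1_bounded g C" "\<And>a. norm (f a) \<le> norm (g a)"
  shows "l1_bounded f C"
proof (rule l1_boundedI)
  fix F :: "'a set" assume F: "finite F"
  have "(\<Sum>a\<in>F. norm (f a)) \<le> (\<Sum>a\<in>F. norm (g a))"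
    by (rule sum_mono) (rule assms(2))
  then show "(\<Sum>a\<in>F. norm (f a)) \<le> C"
    using l1_boundedD[OF assms(1) F] by linarith
qed

lemma l1_bounded_le: "l1_bounded f C \<Longrightarrow> C \<le> D \<Longrightarrow> l1_bounded f D"
  by (force simp: l1_bounded_def)

lemma l1_bounded_zero: "0 \<le> C \<Longrightarrow> l1_bounded (\<lambda>_. 0) C"
  by (simp add: l1_bounded_def)

lemma l1_bounded_add:
  assumes "l1_bounded f C" "l1_bounded g D"
  shows "l1_bounded (\<lambda>a. f a + g a) (C + D)"
proof (rule l1_boundedI)
  fix F :: "'a set" assume F: "finite F"
  have "(\<Sum>a\<in>F. norm (f a + g a)) \<le> (\<Sum>a\<in>F. norm (f a)) + (\<Sum>a\<in>F. norm (g a))"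
    by (simp add: sum.distrib[symmetric] norm_triangle_ineq sum_mono)
  then show "(\<Sum>a\<in>F. norm (f a + g a)) \<le> C + D"
    using l1_boundedD[OF assms(1) F] l1_boundedD[OF assms(2) F] by linarith
qed

lemma l1_bounded_uminus: "l1_bounded f C \<Longrightarrow> l1_bounded (\<lambda>a. - f a) C"
  by (simp add: l1_bounded_def)

lemma l1_bounded_diff:
  assumes "l1_bounded f C" "l1_bounded g D"
  shows "l1_bounded (\<lambda>a. f a - g a) (C + D)"
  using l1_bounded_add[OF assms(1) l1_bounded_uminus[OF assms(2)]] by simp

lemma l1_bounded_cmult:
  fixes f :: "'a \<Rightarrow> 'b::real_normed_div_algebra"
  assumes "l1_bounded f C"
  shows "l1_bounded (\<lambda>a. k * f a) (norm k * C)"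
proof (rule l1_boundedI)
  fix F :: "'a set" assume F: "finite F"
  show "(\<Sum>a\<in>F. norm (k * f a)) \<le> norm k * C"
    by (simp add: norm_mult sum_distrib_left[symmetric] l1_boundedD[OF assms F] mult_left_mono)
qed

lemma l1_bounded_reindex:
  assumes "l1_bounded f C" "inj h"
  shows "l1_bounded (\<lambda>a. f (h a)) C"
proof (rule l1_boundedI)
  fix F :: "'c set" assume F: "finite F"
  have "(\<Sum>a\<in>F. norm (f (h a))) = (\<Sum>a\<in>h ` F. norm (f a))"
    using assms(2) by (subst sum.reindex) (auto intro: inj_on_subset)
  then show "(\<Sum>a\<in>F. norm (f (h a))) \<le> C"
    using l1_boundedD[OF assms(1), of "h ` F"] F by simp
qed

lemma l1_bounded_finite_support:
  assumes "finite S" "\<And>a. a \<notin> S \<Longrightarrow> f a = 0" "(\<Sum>a\<in>S. norm (f a)) \<le> C"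
  shows "l1_bounded f C"
proof (rule l1_boundedI)
  fix F :: "'a set" assume F: "finite F"
  have "(\<Sum>a\<in>F. norm (f a)) = (\<Sum>a\<in>F \<inter> S. norm (f a))"
    by (rule sum.mono_neutral_right) (use F assms(2) in auto)
  also have "\<dots> \<le> (\<Sum>a\<in>S. norm (f a))"
    by (rule sum_mono2) (use assms(1) in auto)
  finally show "(\<Sum>a\<in>F. norm (f a)) \<le> C" using assms(3) by simp
qed

text \<open>Fatou's lemma for families: bounding finite partial sums, rather than an infinite sum,
  lets the bound pass to entrywise limits directly.\<close>

lemma l1_bounded_tendsto:
  assumes "\<And>a. (\<lambda>i. f i a) \<longlonglongrightarrow> g a" "\<forall>\<^sub>F i in sequentially. l1_bounded (f i) C"
  shows "l1_bounded g C"
proof (rule l1_boundedI)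
  fix F :: "'a set" assume F: "finite F"
  have "(\<lambda>i. \<Sum>a\<in>F. norm (f i a)) \<longlonglongrightarrow> (\<Sum>a\<in>F. norm (g a))"
    by (intro tendsto_intros assms)
  moreover have "\<forall>\<^sub>F i in sequentially. (\<Sum>a\<in>F. norm (f i a)) \<le> C"
    using assms(2) by eventually_elim (use F in \<open>auto intro: l1_boundedD\<close>)
  ultimately show "(\<Sum>a\<in>F. norm (g a)) \<le> C"
    by (intro tendsto_upperbound) auto
qed

text \<open>An M-test whose terms are families. The perturbation series and the telescoped iteration
  both need entrywise convergence together with an l1 bound on the sum.\<close>

lemma l1_bounded_suminf:
  fixes g :: "nat \<Rightarrow> 'a \<Rightarrow> 'b::banach"
  assumes g: "\<And>r. l1_bounded (g r) (K r)" and K: "summable K"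
  shows "summable (\<lambda>r. g r a)" and "l1_bounded (\<lambda>a. \<Sum>r. g r a) (suminf K)"
proof -
  show s: "summable (\<lambda>r. g r a)" for a
    by (rule summable_comparison_test'[OF K]) (rule l1_bounded_norm_le[OF g])
  have K0: "0 \<le> K r" for r using l1_bounded_nonneg[OF g] .
  show "l1_bounded (\<lambda>a. \<Sum>r. g r a) (suminf K)"
  proof (rule l1_bounded_tendsto[where f = "\<lambda>i a. \<Sum>r<i. g r a"])
    show "(\<lambda>i. \<Sum>r<i. g r a) \<longlonglongrightarrow> (\<Sum>r. g r a)" for a
      using s by (rule summable_LIMSEQ)
    have fin: "l1_bounded (\<lambda>a. \<Sum>r<i. g r a) (\<Sum>r<i. K r)" for i
      by (induction i) (simp_all add: l1_bounded_zero l1_bounded_add g)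
    have "(\<Sum>r<i. K r) \<le> suminf K" for i
      using K K0 by (intro sum_le_suminf) auto
    with fin show "\<forall>\<^sub>F i in sequentially. l1_bounded (\<lambda>a. \<Sum>r<i. g r a) (suminf K)"
      by (intro always_eventually allI) (rule l1_bounded_le)
  qed
qed

lemma l1_bounded_matrix_vector_summable:
  fixes M :: "'a \<Rightarrow> 'c \<Rightarrow> 'b::{real_normed_field, banach}"
  assumes M: "\<And>c. l1_bounded (\<lambda>a. M a c) C" and x: "l1_bounded x D"
  shows "(\<lambda>c. norm (M a c * x c)) summable_on UNIV" and "(\<lambda>c. M a c * x c) summable_on UNIV"
proof -
  show *: "(\<lambda>c. norm (M a c * x c)) summable_on UNIV"
  proof (rule summable_on_comparison_test)
    show "(\<lambda>c. C * norm (x c)) summable_on UNIV"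
      by (intro summable_on_cmult_right l1_bounded_summable[OF x])
    show "norm (M a c * x c) \<le> C * norm (x c)" for c
      by (simp add: norm_mult l1_bounded_norm_le[OF M] mult_right_mono)
  qed auto
  show "(\<lambda>c. M a c * x c) summable_on UNIV"
    using * by (rule abs_summable_summable)
qed

lemma infsum_finite_sum:
  fixes f :: "'a \<Rightarrow> 'c \<Rightarrow> 'b::real_normed_vector"
  assumes "finite F" "\<And>a. a \<in> F \<Longrightarrow> f a summable_on A"
  shows "(\<Sum>\<^sub>\<infinity>c\<in>A. \<Sum>a\<in>F. f a c) = (\<Sum>a\<in>F. infsum (f a) A)"
    and "(\<lambda>c. \<Sum>a\<in>F. f a c) summable_on A"
proof -
  have "((\<lambda>c. \<Sum>a\<in>F. f a c) has_sum (\<Sum>a\<in>F. infsum (f a) A)) A"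
    using assms by (induction F rule: finite_induct) (simp_all add: has_sum_add has_sum_infsum)
  then show "(\<Sum>\<^sub>\<infinity>c\<in>A. \<Sum>a\<in>F. f a c) = (\<Sum>a\<in>F. infsum (f a) A)"
    "(\<lambda>c. \<Sum>a\<in>F. f a c) summable_on A"
    by (auto simp: infsumI summable_on_def)
qed

text \<open>On l1 the operator norm is the supremum of the column sums. Testing finitely many rows
  at a time turns the interchange of two infinite sums into one with a finite sum. The lemma serves
  matrix products column by column and, with the matrix \<open>e (m + r)\<close>, also
  correlations.\<close>

lemma l1_bounded_matrix_vector:
  fixes M :: "'a \<Rightarrow> 'c \<Rightarrow> 'b::{real_normed_field, banach}"
  assumes M: "\<And>c. l1_bounded (\<lambda>a. M a c) C" and x: "l1_bounded x D"
  shows "l1_bounded (\<lambda>a. \<Sum>\<^sub>\<infinity>c. M a c * x c) (C * D)"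
proof (rule l1_boundedI)
  fix F :: "'a set" assume F: "finite F"
  have C0: "0 \<le> C" using l1_bounded_nonneg[OF M] .
  have s: "(\<lambda>c. norm (M a c * x c)) summable_on UNIV" for a
    by (rule l1_bounded_matrix_vector_summable(1)[OF M x])
  have "(\<Sum>a\<in>F. norm (\<Sum>\<^sub>\<infinity>c. M a c * x c)) \<le> (\<Sum>a\<in>F. \<Sum>\<^sub>\<infinity>c. norm (M a c * x c))"
    by (intro sum_mono norm_infsum_bound s)
  also have "\<dots> = (\<Sum>\<^sub>\<infinity>c. \<Sum>a\<in>F. norm (M a c * x c))"
    by (rule infsum_finite_sum(1)[symmetric, OF F s])
  also have "\<dots> \<le> (\<Sum>\<^sub>\<infinity>c. C * norm (x c))"
  proof (rule infsum_mono)
    show "(\<lambda>c. \<Sum>a\<in>F. norm (M a c * x c)) summable_on UNIV"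
      by (intro infsum_finite_sum(2) F s)
    show "(\<lambda>c. C * norm (x c)) summable_on UNIV"
      by (intro summable_on_cmult_right l1_bounded_summable[OF x])
    show "(\<Sum>a\<in>F. norm (M a c * x c)) \<le> C * norm (x c)" for c
      by (simp add: norm_mult sum_distrib_right[symmetric] l1_boundedD[OF M F] mult_right_mono)
  qed
  also have "\<dots> = C * (\<Sum>\<^sub>\<infinity>c. norm (x c))"
    by (rule infsum_cmult_right')
  also have "\<dots> \<le> C * D"
    by (intro mult_left_mono l1_bounded_infsum_le x C0)
  finally show "(\<Sum>a\<in>F. norm (\<Sum>\<^sub>\<infinity>c. M a c * x c)) \<le> C * D" .
qed

text \<open>Completeness of l1 in the form used by the iteration: entries converge by telescoping,
  and the error after \<open>i\<close> steps is the tail of the geometric series of step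
  sizes.\<close>

lemma l1_geometric_limit:
  fixes w :: "nat \<Rightarrow> 'a \<Rightarrow> 'b::banach"
  assumes w: "\<And>i. l1_bounded (\<lambda>n. w (Suc i) n - w i n) (\<theta> ^ (i + 1))" and \<theta>: "0 \<le> \<theta>" "\<theta> < 1"
  obtains w' where "\<And>i. l1_bounded (\<lambda>n. w' n - w i n) (\<theta> ^ (i + 1) / (1 - \<theta>))"
proof -
  have geo: "(\<lambda>r. \<theta> ^ (r + i + 1)) sums (\<theta> ^ (i + 1) / (1 - \<theta>))" for i
    using sums_mult[OF geometric_sums, of \<theta> "\<theta> ^ (i + 1)"] \<theta> by (simp add: power_add mult_ac)
  have "summable (\<lambda>r. w (Suc (r + 0)) n - w (r + 0) n)" for n
    by (rule l1_bounded_suminf(1)[OF w]) (use geo[of 0] in \<open>auto simp: sums_iff\<close>)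
  then have "convergent (\<lambda>r. w r n - w 0 n)" for n
    using sum_lessThan_telescope[of "\<lambda>i. w i n" for n] by (simp add: summable_iff_convergent)
  then have "convergent (\<lambda>r. w r n)" for n
    by (rule convergent_diff_const_right_iff[THEN iffD1])
  then have "\<forall>n. \<exists>x. (\<lambda>r. w r n) \<longlonglongrightarrow> x"
    by (simp add: convergent_def)
  then obtain w' where w': "\<And>n. (\<lambda>r. w r n) \<longlonglongrightarrow> w' n"
    by metis
  have "l1_bounded (\<lambda>n. w' n - w i n) (\<theta> ^ (i + 1) / (1 - \<theta>))" for i
  proof -
    have "l1_bounded (\<lambda>n. \<Sum>r. w (Suc (r + i)) n - w (r + i) n) (\<Sum>r. \<theta> ^ (r + i + 1))"
      by (rule l1_bounded_suminf(2)[OF w]) (use geo[of i] in \<open>auto simp: sums_iff\<close>)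
    moreover have "(\<lambda>r. w (Suc (r + i)) n - w (r + i) n) sums (w' n - w i n)" for n
      using telescope_sums[OF LIMSEQ_ignore_initial_segment[OF w', of i]] by simp
    ultimately show ?thesis
      using geo[of i] by (simp add: sums_iff)
  qed
  then show thesis by (rule that)
qed

subsection \<open>Absolutely convergent Fourier series\<close>

text \<open>Fubini on the cube: the character and the indicator of the cube both factor over the
  coordinates.\<close>

lemma integral_cis_box_prod:
  fixes c :: "real ^ 'n"
  shows "(LINT x:cbox 0 (\<chi> s. 2 * pi)|lborel. cis (c \<bullet> x)) =
    (\<Prod>b\<in>Basis. LINT y:{0..2 * pi}|lborel. cis ((c \<bullet> b) * y))"
proof -
  define F :: "real ^ 'n \<Rightarrow> real \<Rightarrow> complex"
    where "F b y = indicator {0..2 * pi} y *\<^sub>R cis ((c \<bullet> b) * y)" for b y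
  interpret product_sigma_finite "\<lambda>_ :: real ^ 'n. lborel :: real measure"
    by unfold_locales
  have box: "indicator (cbox 0 (\<chi> s. 2 * pi)) x *\<^sub>R cis (c \<bullet> x) = (\<Prod>b\<in>Basis. F b (x \<bullet> b))"
    for x :: "real ^ 'n"
  proof -
    have "indicator (cbox 0 (\<chi> s. 2 * pi)) x = (\<Prod>b\<in>Basis. indicator {0..2 * pi} (x \<bullet> b) :: real)"
      by (auto simp: cbox_def indicator_def Basis_vec_def inner_axis intro!: prod.neutral)
    moreover have "cis (c \<bullet> x) = (\<Prod>b\<in>Basis. cis ((c \<bullet> b) * (x \<bullet> b)))"
      by (subst euclidean_inner) (simp add: cis_conv_exp sum_distrib_left exp_sum)
    ultimately show ?thesis
      by (simp add: F_def scaleR_conv_of_real prod.distrib)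
  qed
  have int: "integrable lborel (F b)" for b
    unfolding F_def by (intro borel_integrable_atLeastAtMost' [unfolded set_integrable_def] continuous_intros)
  have [measurable]: "F b \<in> borel_measurable borel" for b
    using int[of b] by simp
  have "(LINT x:cbox 0 (\<chi> s. 2 * pi)|lborel. cis (c \<bullet> x)) = (\<integral>x. (\<Prod>b\<in>Basis. F b (x \<bullet> b)) \<partial>lborel)"
    by (simp add: set_lebesgue_integral_def box)
  \<comment> \<open>By \<open>lborel_eq\<close> the measure is the image of a product of
    one-dimensional Lebesgue measures, so the integrand can be read in coordinates.\<close>
  also have "\<dots> = (\<integral>f. (\<Prod>b\<in>Basis. F b ((\<Sum>b\<in>Basis. f b *\<^sub>R b) \<bullet> b))
      \<partial>(\<Pi>\<^sub>M b\<in>(Basis :: (real ^ 'n) set). (lborel :: real measure)))"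
    by (subst lborel_eq, subst integral_distr) simp_all
  also have "\<dots> = (\<integral>f. (\<Prod>b\<in>Basis. F b (f b))
      \<partial>(\<Pi>\<^sub>M b\<in>(Basis :: (real ^ 'n) set). (lborel :: real measure)))"
    by simp
  also have "\<dots> = (\<Prod>b\<in>Basis. \<integral>y. F b y \<partial>lborel)"
    by (rule product_integral_prod) (use int in auto)
  finally show ?thesis
    by (simp add: F_def set_lebesgue_integral_def)
qed

lemma integral_cis_period:
  fixes k :: int
  shows "(LINT y:{0..2 * pi}|lborel. cis (real_of_int k * y)) = (if k = 0 then 2 * pi else 0)"
proof (cases "k = 0")
  case True
  then show ?thesis by (simp add: set_integral_const scaleR_conv_of_real)
next
  case False
  have ii: "- (\<i> * (a * (\<i> * z))) = a * z" for a z
    using i_squared by algebra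
  have "((\<lambda>y. cis (real_of_int k * y)) has_integral
      (cis (real_of_int k * (2 * pi)) / (\<i> * of_int k) - cis (real_of_int k * 0) / (\<i> * of_int k))) {0..2 * pi}"
    using False
    by (intro fundamental_theorem_of_calculus)
       (auto intro!: derivative_eq_intros simp: has_vector_derivative_def fun_eq_iff scaleR_conv_of_real ii)
  moreover have "cis (real_of_int k * (2 * pi)) = 1"
    by (metis cis_multiple_2pi Ints_of_int mult.commute)
  moreover have "set_integrable lborel {0..2 * pi} (\<lambda>y. cis (real_of_int k * y))"
    by (intro borel_integrable_atLeastAtMost' continuous_intros)
  ultimately show ?thesis
    using False by (simp add: set_borel_integral_eq_integral(2) integral_unique)
qed

lemma lat_simps [simp]: "lat 0 = 0" "lat (a + b) = lat a + lat b" "lat (a - b) = lat a - lat b"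
    "lat (- a) = - lat a"
  by (simp_all add: lat_def vec_eq_iff)

lemma integral_cis_lat:
  fixes m :: "int ^ 'n"
  shows "(LINT x:cbox 0 (\<chi> s. 2 * pi)|lborel. cis (lat m \<bullet> x)) =
    (if m = 0 then (2 * pi) ^ CARD('n) else 0)"
proof -
  have "(LINT x:cbox 0 (\<chi> s. 2 * pi)|lborel. cis (lat m \<bullet> x)) =
      (\<Prod>b\<in>Basis. LINT y:{0..2 * pi}|lborel. cis ((lat m \<bullet> b) * y))"
    by (rule integral_cis_box_prod)
  also have "\<dots> = (\<Prod>i\<in>UNIV. LINT y:{0..2 * pi}|lborel. cis ((lat m \<bullet> axis i 1) * y))"
    by (rule prod.reindex_bij_betw [symmetric])
       (auto simp: bij_betw_def inj_on_def Basis_vec_def axis_eq_axis)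
  also have "\<dots> = (\<Prod>i\<in>UNIV. if m $ i = 0 then 2 * pi else 0)"
    by (simp add: inner_axis lat_def integral_cis_period)
  also have "\<dots> = (if m = 0 then (2 * pi) ^ CARD('n) else 0)"
    by (auto simp: vec_eq_iff)
  finally show ?thesis .
qed

lemma fourier_coeff_cnj: "fourier_coeff W (- m) = cnj (fourier_coeff W m)"
proof -
  have "(\<integral>x. indicator S x *\<^sub>R (complex_of_real (W x) * cis (lat m \<bullet> x)) \<partial>lborel) =
      cnj (\<integral>x. indicator S x *\<^sub>R (complex_of_real (W x) * cis (- (lat m \<bullet> x))) \<partial>lborel)" for S
    unfolding Bochner_Integration.integral_cnj[symmetric]
    by (rule Bochner_Integration.integral_cong) (simp_all add: cis_cnj scaleR_conv_of_real)
  then show ?thesis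
    by (simp add: fourier_coeff_def set_lebesgue_integral_def)
qed

text \<open>The coefficients are a separate argument because iterates and limit are built from them;
  that they are the values of \<open>fourier_coeff\<close> is derived afterwards. Equality is
  demanded at every point, not almost everywhere, since continuity and periodicity are read off from
  it.\<close>

definition has_fourier_series :: "(real ^ 'n \<Rightarrow> real) \<Rightarrow> (int ^ 'n \<Rightarrow> complex) \<Rightarrow> bool" where
  "has_fourier_series W c \<longleftrightarrow> (\<lambda>m. norm (c m)) summable_on UNIV \<and>
     (\<forall>x. complex_of_real (W x) = (\<Sum>\<^sub>\<infinity>m. c m * cis (lat m \<bullet> x)))"

lemma fourier_series_summable:
  assumes "(\<lambda>m. norm (c m)) summable_on UNIV"
  shows "(\<lambda>m. c m * cis (lat m \<bullet> x)) summable_on UNIV"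
  by (rule abs_summable_summable) (use assms in \<open>simp add: norm_mult\<close>)

lemma fourier_series_uniform_limit:
  assumes "(\<lambda>m. norm (c m)) summable_on UNIV"
  shows "uniform_limit S (\<lambda>F x. \<Sum>m\<in>F. c m * cis (lat m \<bullet> x))
    (\<lambda>x. \<Sum>\<^sub>\<infinity>m. c m * cis (lat m \<bullet> x)) (finite_subsets_at_top UNIV)"
  by (rule Weierstrass_m_test_general[OF _ assms]) (simp add: norm_mult)

lemma continuous_on_fourier_series:
  assumes "(\<lambda>m. norm (c m)) summable_on UNIV"
  shows "continuous_on S (\<lambda>x. \<Sum>\<^sub>\<infinity>m. c m * cis (lat m \<bullet> x))"
  by (rule uniform_limit_theorem[OF _ fourier_series_uniform_limit[OF assms]])
     (auto intro!: always_eventually continuous_intros)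

lemma has_fourier_series_continuous:
  assumes "has_fourier_series W c"
  shows "continuous_on S W"
proof -
  have "continuous_on S (\<lambda>x. Re (complex_of_real (W x)))"
    using assms unfolding has_fourier_series_def
    by (auto intro!: continuous_intros continuous_on_fourier_series)
  then show ?thesis by simp
qed

lemma cis_lat_periodic: "cis (lat m \<bullet> (x + (2 * pi) *\<^sub>R axis s 1)) = cis (lat m \<bullet> x)"
proof -
  have "lat m \<bullet> (x + (2 * pi) *\<^sub>R axis s 1) = lat m \<bullet> x + 2 * pi * real_of_int (m $ s)"
    by (simp add: inner_add_right inner_axis lat_def)
  then show ?thesis by (simp add: cis_multiple_2pi flip: cis_mult)
qed

lemma has_fourier_series_periodic:
  assumes "has_fourier_series W c"
  shows "periodic W"
  using assms unfolding has_fourier_series_def periodic_def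
  by (metis (no_types, lifting) cis_lat_periodic infsum_cong of_real_eq_iff)

text \<open>Partial sums multiplied by \<open>cis (- (lat m \<bullet> x))\<close> converge
  uniformly, hence so do their integrals, and orthogonality of the characters isolates
  \<open>c m\<close>.\<close>

lemma has_fourier_series_fourier_coeff:
  fixes W :: "real ^ 'n \<Rightarrow> real"
  assumes W: "has_fourier_series W c"
  shows "fourier_coeff W m = c m"
proof -
  let ?Q = "cbox 0 (\<chi> s. 2 * pi) :: (real ^ 'n) set"
  have sc: "(\<lambda>m. norm (c m)) summable_on UNIV"
    using W by (simp add: has_fourier_series_def)
  let ?g = "\<lambda>x. complex_of_real (W x) * cis (- (lat m \<bullet> x))"
  let ?f = "\<lambda>F x. \<Sum>k\<in>F. c k * cis (lat (k - m) \<bullet> x)"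
  have cis: "c k * cis (lat (k - m) \<bullet> x) = c k * cis (lat k \<bullet> x) * cis (- (lat m \<bullet> x))" for k x
    by (simp add: inner_diff_left cis_mult)
  have g: "?g = (\<lambda>x. \<Sum>\<^sub>\<infinity>k. c k * cis (lat (k - m) \<bullet> x))"
    using W unfolding cis infsum_cmult_left' by (simp add: has_fourier_series_def)
  have "uniform_limit ?Q ?f ?g (finite_subsets_at_top UNIV)"
    unfolding g by (rule Weierstrass_m_test_general[OF _ sc]) (simp add: norm_mult cis)
  then obtain I J where I: "\<And>F. (?f F has_integral I F) ?Q" and J: "(?g has_integral J) ?Q"
    and lim: "(I \<longlongrightarrow> J) (finite_subsets_at_top UNIV)"
    by (rule uniform_limit_integral_cbox) (auto intro!: continuous_intros)
  have int: "set_integrable lborel ?Q f" if "continuous_on ?Q f" for f :: "real ^ 'n \<Rightarrow> complex"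
    unfolding set_integrable_def by (rule borel_integrable_compact) (use that in auto)
  \<comment> \<open>As soon as \<open>F\<close> contains \<open>m\<close> the integral no longer
    depends on \<open>F\<close>, so the limit along finite sets is that of an eventually constant
    net.\<close>
  have "I F = c m * (2 * pi) ^ CARD('n)" if F: "finite F" "m \<in> F" for F
  proof -
    have "I F = (LINT x:?Q|lborel. ?f F x)"
      using I[of F]
      by (subst set_borel_integral_eq_integral)
         (auto intro!: int continuous_intros simp: integral_unique)
    also have "\<dots> = (\<Sum>k\<in>F. LINT x:?Q|lborel. c k * cis (lat (k - m) \<bullet> x))"
      unfolding set_lebesgue_integral_def scaleR_sum_right
      by (rule Bochner_Integration.integral_sum)
         (intro int[unfolded set_integrable_def] continuous_intros)
    also have "\<dots> = (\<Sum>k\<in>F. c k * (if k = m then (2 * pi) ^ CARD('n) else 0))"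
      using integral_cis_lat[of "_ - m"] by (intro sum.cong) auto
    also have "\<dots> = c m * (2 * pi) ^ CARD('n)"
      using F by (subst sum.remove[of _ m]) auto
    finally show ?thesis .
  qed
  then have "\<forall>\<^sub>F F in finite_subsets_at_top UNIV. I F = c m * (2 * pi) ^ CARD('n)"
    unfolding eventually_finite_subsets_at_top by (intro exI[of _ "{m}"]) auto
  then have "(I \<longlongrightarrow> c m * (2 * pi) ^ CARD('n)) (finite_subsets_at_top UNIV)"
    by (rule tendsto_eventually)
  then have "J = c m * (2 * pi) ^ CARD('n)"
    using lim by (metis tendsto_unique finite_subsets_at_top_neq_bot)
  moreover have "(LINT x:?Q|lborel. ?g x) = J"
    using J by (subst set_borel_integral_eq_integral)
      (auto intro!: int continuous_intros has_fourier_series_continuous[OF W] simp: integral_unique)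
  ultimately show ?thesis
    by (simp add: fourier_coeff_def)
qed

lemma has_fourier_series_star_norm_le:
  assumes W: "has_fourier_series W c" and c: "l1_bounded c C"
  shows "star_norm W \<le> ennreal C"
proof -
  have "star_norm W = (\<Sum>\<^sub>\<infinity>m. ennreal (cmod (c m)))"
    by (simp add: star_norm_def has_fourier_series_fourier_coeff[OF W])
  also have "\<dots> \<le> ennreal C"
  proof (rule infsum_le_finite_sums)
    fix F :: "(int ^ 'a) set" assume "finite F"
    then show "(\<Sum>m\<in>F. ennreal (cmod (c m))) \<le> ennreal C"
      using l1_boundedD[OF c] by (simp add: sum_ennreal ennreal_leI)
  qed (rule nonneg_summable_on_complete, simp)
  finally show ?thesis .
qed

lemma has_fourier_series_star_potential:
  assumes W: "has_fourier_series W c"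
  shows "star_potential W"
proof -
  have "l1_bounded c (\<Sum>\<^sub>\<infinity>m. norm (c m))"
    using W by (auto simp: has_fourier_series_def l1_bounded_iff)
  from has_fourier_series_star_norm_le[OF W this] have "star_norm W < \<infinity>"
    by (simp add: le_less_trans ennreal_less_top)
  moreover have "set_integrable lborel (cbox 0 (\<chi> s. 2 * pi)) W"
    unfolding set_integrable_def
    by (rule borel_integrable_compact) (auto intro: has_fourier_series_continuous[OF W])
  ultimately show ?thesis
    using has_fourier_series_periodic[OF W] by (simp add: star_potential_def)
qed

lemma infsum_diff:
  fixes f g :: "'a \<Rightarrow> 'b::real_normed_vector"
  assumes "f summable_on A" "g summable_on A"
  shows "(\<Sum>\<^sub>\<infinity>x\<in>A. f x - g x) = infsum f A - infsum g A"
proof -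
  have "(\<lambda>x. - g x) summable_on A"
    using assms(2) by (simp add: summable_on_uminus)
  from infsum_add[OF assms(1) this] show ?thesis
    by (simp add: infsum_uminus)
qed

lemma has_fourier_series_diff:
  assumes "has_fourier_series W c" "has_fourier_series W' c'"
  shows "has_fourier_series (\<lambda>x. W x - W' x) (\<lambda>m. c m - c' m)"
proof -
  have s: "(\<lambda>m. norm (c m)) summable_on UNIV" "(\<lambda>m. norm (c' m)) summable_on UNIV"
    using assms by (auto simp: has_fourier_series_def)
  then have "(\<lambda>m. norm (c m - c' m)) summable_on UNIV"
    by (metis l1_bounded_diff l1_bounded_iff order_refl)
  moreover have "(\<Sum>\<^sub>\<infinity>m. (c m - c' m) * cis (lat m \<bullet> x)) =
      (\<Sum>\<^sub>\<infinity>m. c m * cis (lat m \<bullet> x)) - (\<Sum>\<^sub>\<infinity>m. c' m * cis (lat m \<bullet> x))" for x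
    unfolding left_diff_distrib by (intro infsum_diff fourier_series_summable s)
  ultimately show ?thesis
    using assms by (simp add: has_fourier_series_def)
qed

text \<open>Nothing is lost by taking the real part: l1 convergence of coefficients is uniform
  convergence of functions, so the limit series lies within \<open>\<epsilon> i\<close> of a real
  value for every \<open>i\<close> and its imaginary part vanishes.\<close>

lemma has_fourier_series_limit:
  assumes W: "\<And>i. has_fourier_series (W i) (w i)"
    and w': "\<And>i::nat. l1_bounded (\<lambda>n. w' n - w i n) (\<epsilon> i)" and \<epsilon>: "\<epsilon> \<longlonglongrightarrow> 0"
  shows "has_fourier_series (\<lambda>x. Re (\<Sum>\<^sub>\<infinity>m. w' m * cis (lat m \<bullet> x))) w'"
proof -
  let ?f = "\<lambda>x. \<Sum>\<^sub>\<infinity>m. w' m * cis (lat m \<bullet> x)"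
  have sw: "(\<lambda>m. norm (w i m)) summable_on UNIV" for i
    using W by (simp add: has_fourier_series_def)
  then have "l1_bounded (w 0) (\<Sum>\<^sub>\<infinity>m. norm (w 0 m))"
    by (simp add: l1_bounded_iff)
  from l1_bounded_add[OF w'[of 0] this] have sw': "(\<lambda>m. norm (w' m)) summable_on UNIV"
    by (simp add: l1_bounded_summable)
  have "?f x = complex_of_real (Re (?f x))" for x
  proof -
    have "norm (?f x - complex_of_real (W i x)) \<le> \<epsilon> i" for i
    proof -
      have "?f x - complex_of_real (W i x) = (\<Sum>\<^sub>\<infinity>m. (w' m - w i m) * cis (lat m \<bullet> x))"
        using W[of i] fourier_series_summable[OF sw'] fourier_series_summable[OF sw[of i]]
        unfolding left_diff_distrib has_fourier_series_def by (simp add: infsum_diff)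
      also have "norm \<dots> \<le> (\<Sum>\<^sub>\<infinity>m. norm ((w' m - w i m) * cis (lat m \<bullet> x)))"
        by (rule norm_infsum_bound) (simp add: norm_mult l1_bounded_summable[OF w'])
      also have "\<dots> \<le> \<epsilon> i"
        using l1_bounded_infsum_le[OF w'] by (simp add: norm_mult)
      finally show ?thesis .
    qed
    then have "\<bar>Im (?f x)\<bar> \<le> \<epsilon> i" for i
      using abs_Im_le_cmod[of "?f x - complex_of_real (W i x)"] by (force intro: order_trans)
    then have "\<bar>Im (?f x)\<bar> \<le> 0"
      using \<epsilon> by (intro LIMSEQ_le_const) auto
    then show ?thesis by (simp add: complex_eq_iff)
  qed
  then show ?thesis
    using sw' by (simp add: has_fourier_series_def)
qed

lemma has_fourier_series_add:
  assumes "has_fourier_series W c" "has_fourier_series W' c'"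
  shows "has_fourier_series (\<lambda>x. W x + W' x) (\<lambda>m. c m + c' m)"
proof -
  have s: "(\<lambda>m. norm (c m)) summable_on UNIV" "(\<lambda>m. norm (c' m)) summable_on UNIV"
    using assms by (auto simp: has_fourier_series_def)
  then have "(\<lambda>m. norm (c m + c' m)) summable_on UNIV"
    by (metis l1_bounded_add l1_bounded_iff order_refl)
  moreover have "(\<Sum>\<^sub>\<infinity>m. (c m + c' m) * cis (lat m \<bullet> x)) =
      (\<Sum>\<^sub>\<infinity>m. c m * cis (lat m \<bullet> x)) + (\<Sum>\<^sub>\<infinity>m. c' m * cis (lat m \<bullet> x))" for x
    unfolding distrib_right by (intro infsum_add fourier_series_summable s)
  ultimately show ?thesis
    using assms by (simp add: has_fourier_series_def)
qed

lemma has_fourier_series_cmult: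
  assumes "has_fourier_series W c"
  shows "has_fourier_series (\<lambda>x. r * W x) (\<lambda>m. complex_of_real r * c m)"
  using assms unfolding has_fourier_series_def
  by (auto simp: norm_mult mult.assoc infsum_cmult_right' intro: summable_on_cmult_right)

lemma has_fourier_series_unique:
  "has_fourier_series W c \<Longrightarrow> fourier_coeff W = c"
  by (simp add: fun_eq_iff has_fourier_series_fourier_coeff)

section \<open>Autocorrelations and the Fourier series of a squared modulus\<close>

definition correlation :: "(int ^ 'n \<Rightarrow> complex) \<Rightarrow> (int ^ 'n \<Rightarrow> complex) \<Rightarrow> int ^ 'n \<Rightarrow> complex"
  where "correlation e f m = (\<Sum>\<^sub>\<infinity>r. e (m + r) * cnj (f r))"

lemma correlation_summable:
  fixes e f :: "int ^ 'n \<Rightarrow> complex"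
  assumes "l1_bounded e C" "l1_bounded f D"
  shows "(\<lambda>r. e (m + r) * cnj (f r)) summable_on UNIV"
proof -
  have "l1_bounded (\<lambda>m. e (m + r)) C" for r
    by (rule l1_bounded_reindex[OF assms(1)]) (auto simp: inj_def)
  moreover have "l1_bounded (\<lambda>r. cnj (f r)) D"
    using assms(2) by (simp add: l1_bounded_def)
  ultimately show ?thesis
    by (rule l1_bounded_matrix_vector_summable(2))
qed

text \<open>Young's inequality: for each \<open>r\<close> the column \<open>e (m + r)\<close> is a
  translate of \<open>e\<close>, so all column sums share the bound \<open>C\<close>.\<close>

lemma l1_bounded_correlation:
  assumes "l1_bounded e C" "l1_bounded f D"
  shows "l1_bounded (correlation e f) (C * D)"
proof -
  have "l1_bounded (\<lambda>m. e (m + r)) C" for r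
    by (rule l1_bounded_reindex[OF assms(1)]) (auto simp: inj_def)
  moreover have "l1_bounded (\<lambda>r. cnj (f r)) D"
    using assms(2) by (simp add: l1_bounded_def)
  ultimately show ?thesis
    unfolding correlation_def[abs_def] by (rule l1_bounded_matrix_vector)
qed

text \<open>Splits a difference of squares so that each summand contains \<open>e - f\<close> once.
  For this \<open>correlation\<close> takes two sequences, and from here comes the factor 2 in the
  contraction constant.\<close>

lemma correlation_diff:
  assumes "l1_bounded e C" "l1_bounded f D"
  shows "correlation e e m - correlation f f m =
    correlation (\<lambda>s. e s - f s) e m + correlation f (\<lambda>s. e s - f s) m"
proof -
  note [intro] = correlation_summable[OF assms(1,1)] correlation_summable[OF assms(1,2)]
    correlation_summable[OF assms(2,1)] correlation_summable[OF assms(2,2)]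
  show ?thesis
    unfolding correlation_def
    by (simp add: left_diff_distrib right_diff_distrib, subst infsum_diff, blast, blast,
      subst infsum_diff, blast, blast, simp)
qed

text \<open>The double family is absolutely summable, so the order of summation may be exchanged;
  for fixed \<open>r\<close> the shift from \<open>m\<close> to \<open>m + r\<close> then separates
  the two factors.\<close>

lemma fourier_series_correlation:
  assumes e: "l1_bounded e C" and f: "l1_bounded f D"
  shows "(\<Sum>\<^sub>\<infinity>m. correlation e f m * cis (lat m \<bullet> x)) =
    (\<Sum>\<^sub>\<infinity>s. e s * cis (lat s \<bullet> x)) * cnj (\<Sum>\<^sub>\<infinity>s. f s * cis (lat s \<bullet> x))"
proof -
  let ?h = "\<lambda>m r. e (m + r) * cnj (f r) * cis (lat m \<bullet> x)"
  let ?E = "\<Sum>\<^sub>\<infinity>s. e s * cis (lat s \<bullet> x)"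
  have e': "l1_bounded (\<lambda>m. e (m + r)) C" for r
    by (rule l1_bounded_reindex[OF e]) (auto simp: inj_def)
  have f': "l1_bounded (\<lambda>r. cnj (f r)) D"
    using f by (simp add: l1_bounded_def)
  have "(\<lambda>x. norm (case x of (r, m) \<Rightarrow> ?h m r)) summable_on UNIV \<times> UNIV"
  proof (rule Infinite_Sum.abs_summable_on_Sigma_iff[THEN iffD2], intro conjI ballI)
    show "(\<lambda>m. norm (case (r, m) of (r, m) \<Rightarrow> ?h m r)) summable_on UNIV" for r
      using l1_bounded_summable[OF l1_bounded_cmult[OF e', of "cnj (f r)" r]]
      by (simp add: norm_mult mult.commute)
    have le: "(\<Sum>\<^sub>\<infinity>m. norm (?h m r)) \<le> C * norm (f r)" for r
      using l1_bounded_infsum_le[OF l1_bounded_cmult[OF e', of "cnj (f r)" r]]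
      by (simp add: norm_mult mult.commute)
    have nn: "0 \<le> (\<Sum>\<^sub>\<infinity>m. norm (?h m r))" for r
      by (rule infsum_nonneg) simp
    show "(\<lambda>r. norm (\<Sum>\<^sub>\<infinity>m. norm (case (r, m) of (r, m) \<Rightarrow> ?h m r))) summable_on UNIV"
      using le nn
      by (auto intro!: summable_on_comparison_test[where f = "\<lambda>r. C * norm (f r)"]
          summable_on_cmult_right l1_bounded_summable[OF f])
  qed
  then have "(\<lambda>(r, m). ?h m r) summable_on UNIV \<times> UNIV"
    by (rule abs_summable_summable)
  then have swap: "(\<Sum>\<^sub>\<infinity>r. \<Sum>\<^sub>\<infinity>m. ?h m r) = (\<Sum>\<^sub>\<infinity>m. \<Sum>\<^sub>\<infinity>r. ?h m r)"
    by (rule infsum_swap_banach)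
  have "(\<Sum>\<^sub>\<infinity>m. ?h m r) = ?E * cnj (f r * cis (lat r \<bullet> x))" for r
  proof -
    have "bij_betw (\<lambda>m. m + r) UNIV UNIV"
      by (rule bij_betwI[where g = "\<lambda>m. m - r"]) auto
    then have "?E = (\<Sum>\<^sub>\<infinity>m. e (m + r) * cis (lat (m + r) \<bullet> x))"
      by (rule infsum_reindex_bij_betw[symmetric])
    then have "?E * cnj (f r * cis (lat r \<bullet> x)) =
        (\<Sum>\<^sub>\<infinity>m. e (m + r) * cis (lat (m + r) \<bullet> x) * cnj (f r * cis (lat r \<bullet> x)))"
      by (simp only: infsum_cmult_left')
    also have "\<dots> = (\<Sum>\<^sub>\<infinity>m. ?h m r)"
    proof (rule infsum_cong)
      fix m
      have *: "cis (lat (m + r) \<bullet> x) * cnj (cis (lat r \<bullet> x)) = cis (lat m \<bullet> x)"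
        by (simp add: cis_cnj cis_mult inner_add_left)
      show "e (m + r) * cis (lat (m + r) \<bullet> x) * cnj (f r * cis (lat r \<bullet> x)) = ?h m r"
        by (subst *[symmetric]) (simp only: complex_cnj_mult mult_ac)
    qed
    finally show ?thesis by simp
  qed
  then have "(\<Sum>\<^sub>\<infinity>r. \<Sum>\<^sub>\<infinity>m. ?h m r) = ?E * cnj (\<Sum>\<^sub>\<infinity>r. f r * cis (lat r \<bullet> x))"
    by (simp only: infsum_cmult_right' infsum_cnj)
  with swap show ?thesis
    by (simp add: correlation_def infsum_cmult_left')
qed

lemma has_fourier_series_norm_square:
  assumes e: "l1_bounded e C"
  shows "has_fourier_series (\<lambda>x. (cmod (\<Sum>\<^sub>\<infinity>s. e s * cis (lat s \<bullet> x)))\<^sup>2) (correlation e e)"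
  unfolding has_fourier_series_def fourier_series_correlation[OF e e]
  by (simp add: l1_bounded_summable[OF l1_bounded_correlation[OF e e]] complex_norm_square
      del: of_real_power)

subsection \<open>Matrices with bounded column sums\<close>

text \<open>One majorant \<open>B\<close> serves all \<open>z\<close> at once, so that the bound on column sums survives contour
  integration of the entries.\<close>

definition col_bounded :: "complex set \<Rightarrow> (complex \<Rightarrow> 'n::finite lmat) \<Rightarrow> real \<Rightarrow> bool" where
  "col_bounded S M C \<longleftrightarrow> (\<exists>B :: int ^ 'n \<Rightarrow> int ^ 'n \<Rightarrow> real.
     (\<forall>b. l1_bounded (\<lambda>a. B a b) C) \<and> (\<forall>z\<in>S. \<forall>a b. norm (M z a b) \<le> B a b) \<and>
     (\<forall>a b. continuous_on S (\<lambda>z. M z a b)))"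

lemma col_boundedI:
  fixes B :: "int ^ 'n \<Rightarrow> int ^ 'n \<Rightarrow> real" and M :: "complex \<Rightarrow> 'n::finite lmat"
  assumes "\<And>b. l1_bounded (\<lambda>a. B a b) C" "\<And>z a b. z \<in> S \<Longrightarrow> norm (M z a b) \<le> B a b"
    "\<And>a b. continuous_on S (\<lambda>z. M z a b)"
  shows "col_bounded S M C"
  unfolding col_bounded_def by (rule exI[of _ B]) (use assms in auto)

lemma col_boundedE:
  fixes M :: "complex \<Rightarrow> 'n::finite lmat"
  assumes "col_bounded S M C"
  obtains B :: "int ^ 'n \<Rightarrow> int ^ 'n \<Rightarrow> real" where
    "\<And>b. l1_bounded (\<lambda>a. B a b) C" "\<And>z a b. z \<in> S \<Longrightarrow> norm (M z a b) \<le> B a b"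
    "\<And>a b. continuous_on S (\<lambda>z. M z a b)"
  using assms unfolding col_bounded_def by (elim exE conjE) (rule that; blast)

lemma col_bounded_column:
  assumes "col_bounded S M C" "z \<in> S"
  shows "l1_bounded (\<lambda>a. M z a b) C"
proof -
  obtain B where B: "l1_bounded (\<lambda>a. B a b) C" "\<And>a. norm (M z a b) \<le> B a b"
    using assms by (metis col_boundedE)
  show ?thesis
    by (rule l1_bounded_mono[OF B(1)]) (use B(2) in \<open>simp add: order_trans[OF _ abs_ge_self]\<close>)
qed

lemma col_bounded_nonneg: "col_bounded S M C \<Longrightarrow> 0 \<le> C"
  by (metis col_boundedE l1_bounded_nonneg)

lemma col_bounded_le: "col_bounded S M C \<Longrightarrow> C \<le> D \<Longrightarrow> col_bounded S M D"
  unfolding col_bounded_def using l1_bounded_le by blast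

lemma col_bounded_const:
  assumes "\<And>b. l1_bounded (\<lambda>a. M a b) C"
  shows "col_bounded S (\<lambda>_. M) C"
  by (rule col_boundedI[where B = "\<lambda>a b. norm (M a b)"]) (use assms in \<open>auto simp: l1_bounded_def\<close>)

lemma col_bounded_cong:
  assumes "\<And>z a b. z \<in> S \<Longrightarrow> M z a b = N z a b" "col_bounded S M C"
  shows "col_bounded S N C"
proof -
  obtain B where B: "\<And>b. l1_bounded (\<lambda>a. B a b) C" "\<And>z a b. z \<in> S \<Longrightarrow> norm (M z a b) \<le> B a b"
    "\<And>a b. continuous_on S (\<lambda>z. M z a b)" using col_boundedE[OF assms(2)] by blast
  show ?thesis
    by (rule col_boundedI[OF B(1)])
       (use B(2) assms(1) in \<open>auto intro: continuous_on_eq[OF B(3)]\<close>)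
qed

lemma col_bounded_add:
  assumes "col_bounded S M C" "col_bounded S N D"
  shows "col_bounded S (\<lambda>z a b. M z a b + N z a b) (C + D)"
proof -
  obtain B where B: "\<And>b. l1_bounded (\<lambda>a. B a b) C" "\<And>z a b. z \<in> S \<Longrightarrow> norm (M z a b) \<le> B a b"
    "\<And>a b. continuous_on S (\<lambda>z. M z a b)" using col_boundedE[OF assms(1)] by blast
  obtain B' where B': "\<And>b. l1_bounded (\<lambda>a. B' a b) D" "\<And>z a b. z \<in> S \<Longrightarrow> norm (N z a b) \<le> B' a b"
    "\<And>a b. continuous_on S (\<lambda>z. N z a b)" using col_boundedE[OF assms(2)] by blast
  show ?thesis
    by (rule col_boundedI[where B = "\<lambda>a b. B a b + B' a b"])
       (auto intro!: l1_bounded_add B B' continuous_on_add norm_triangle_le add_mono)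
qed

lemma col_bounded_scale:
  assumes "col_bounded S M C" "\<And>a b. norm (f a b) \<le> 1"
  shows "col_bounded S (\<lambda>z a b. f a b * M z a b) C"
proof -
  obtain B where B: "\<And>b. l1_bounded (\<lambda>a. B a b) C" "\<And>z a b. z \<in> S \<Longrightarrow> norm (M z a b) \<le> B a b"
    "\<And>a b. continuous_on S (\<lambda>z. M z a b)" using col_boundedE[OF assms(1)] by blast
  have "norm (f a b * M z a b) \<le> B a b" if "z \<in> S" for z a b
    using B(2)[OF that, of a b] mult_mono[OF assms(2)[of a b], of "norm (M z a b)" "B a b"]
    by (simp add: norm_mult)
  then show ?thesis
    by (intro col_boundedI[where B = B]) (auto intro!: B continuous_intros)
qed

text \<open>The product of the majorants does double duty: it bounds the column sums, and its
  summable terms, independent of \<open>z\<close>, make the entries uniform limits of continuous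
  functions.\<close>

lemma col_bounded_mmult:
  assumes "col_bounded S M C" "col_bounded S N D"
  shows "col_bounded S (\<lambda>z. M z \<odot> N z) (C * D)"
proof -
  obtain B where B: "\<And>b. l1_bounded (\<lambda>a. B a b) C" "\<And>z a b. z \<in> S \<Longrightarrow> norm (M z a b) \<le> B a b"
    "\<And>a b. continuous_on S (\<lambda>z. M z a b)" using col_boundedE[OF assms(1)] by blast
  obtain B' where B': "\<And>b. l1_bounded (\<lambda>a. B' a b) D" "\<And>z a b. z \<in> S \<Longrightarrow> norm (N z a b) \<le> B' a b"
    "\<And>a b. continuous_on S (\<lambda>z. N z a b)" using col_boundedE[OF assms(2)] by blast
  have le: "norm (M z a c * N z c b) \<le> B a c * B' c b" if "z \<in> S" for z a b c
    using B(2)[OF that, of a c] B'(2)[OF that, of c b]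
    by (auto simp: norm_mult intro!: mult_mono intro: order_trans[OF norm_ge_zero])
  have sB: "(\<lambda>c. B a c * B' c b) summable_on UNIV" for a b
    by (rule l1_bounded_matrix_vector_summable(2)[OF B(1) B'(1)])
  have sM: "(\<lambda>c. norm (M z a c * N z c b)) summable_on UNIV" if "z \<in> S" for z a b
    by (rule summable_on_comparison_test[OF sB]) (use le that in auto)
  show ?thesis
  proof (rule col_boundedI)
    show "l1_bounded (\<lambda>a. \<Sum>\<^sub>\<infinity>c. B a c * B' c b) (C * D)" for b
      by (rule l1_bounded_matrix_vector[OF B(1) B'(1)])
    show "norm ((M z \<odot> N z) a b) \<le> (\<Sum>\<^sub>\<infinity>c. B a c * B' c b)" if "z \<in> S" for z a b
      unfolding mmult_def
      by (rule order_trans[OF norm_infsum_bound[OF sM[OF that]]])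
         (intro infsum_mono sM sB le that)
    have "uniform_limit S (\<lambda>F z. \<Sum>c\<in>F. M z a c * N z c b)
        (\<lambda>z. \<Sum>\<^sub>\<infinity>c. M z a c * N z c b) (finite_subsets_at_top UNIV)" for a b
      by (rule Weierstrass_m_test_general[OF _ sB]) (rule le)
    then show "continuous_on S (\<lambda>z. (M z \<odot> N z) a b)" for a b
      unfolding mmult_def
      by (rule uniform_limit_theorem[rotated])
         (auto intro!: always_eventually continuous_intros B B')
  qed
qed

lemma mmult_summable:
  fixes M N :: "'n::finite lmat"
  assumes "\<And>b. l1_bounded (\<lambda>a. M a b) C" "\<And>b. l1_bounded (\<lambda>a. N a b) D"
  shows "(\<lambda>c. M a c * N c b) summable_on UNIV"
  by (rule l1_bounded_matrix_vector_summable(2)[OF assms])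

lemma mmult_diff:
  fixes M M' N N' :: "'n::finite lmat"
  assumes "\<And>b. l1_bounded (\<lambda>a. M a b) C" "\<And>b. l1_bounded (\<lambda>a. M' a b) C'"
    and "\<And>b. l1_bounded (\<lambda>a. N a b) D" "\<And>b. l1_bounded (\<lambda>a. N' a b) D'"
  shows "(M \<odot> N) a b - (M' \<odot> N') a b =
    (M \<odot> (\<lambda>a b. N a b - N' a b)) a b + ((\<lambda>a b. M a b - M' a b) \<odot> N') a b"
proof -
  have s: "(\<lambda>c. M a c * N c b) summable_on UNIV" "(\<lambda>c. M a c * N' c b) summable_on UNIV"
    "(\<lambda>c. M' a c * N' c b) summable_on UNIV"
    by (rule mmult_summable, fact assms, fact assms)+
  show ?thesis
    unfolding mmult_def left_diff_distrib right_diff_distrib infsum_diff[OF s(1,2)]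
      infsum_diff[OF s(2,3)] by simp
qed

lemma col_bounded_funpow:
  assumes "col_bounded S Z \<zeta>" "col_bounded S R C"
  shows "col_bounded S (\<lambda>z. ((\<odot>) (Z z) ^^ r) (R z)) (\<zeta> ^ r * C)"
proof (induction r)
  case 0
  then show ?case using assms(2) by simp
next
  case (Suc r)
  from col_bounded_mmult[OF assms(1) Suc] show ?case by (simp add: mult.assoc)
qed

text \<open>Full telescoping gives a bound of order \<open>r * (1/4) ^ (r - 1) * \<eta> * C\<close>.
  Weakening the ratio to \<open>1/2\<close> absorbs the factor \<open>r\<close> and leaves an
  estimate that closes under induction.\<close>

lemma col_bounded_funpow_diff:
  assumes Z: "col_bounded S Z (1/4)" "col_bounded S Z' (1/4)"
    and D: "col_bounded S (\<lambda>z a b. Z z a b - Z' z a b) \<eta>"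
    and R: "col_bounded S R C"
  shows "col_bounded S (\<lambda>z a b. ((\<odot>) (Z z) ^^ r) (R z) a b - ((\<odot>) (Z' z) ^^ r) (R z) a b)
    (4 * \<eta> * C * (1/2) ^ r)"
proof (induction r)
  have nn: "0 \<le> \<eta>" "0 \<le> C"
    using D R by (auto intro: col_bounded_nonneg)
  case 0
  show ?case
    using nn by (intro col_boundedI[where B = "\<lambda>a b. 0"]) (auto simp: l1_bounded_zero)
next
  case (Suc r)
  have nn: "0 \<le> \<eta>" "0 \<le> C"
    using D R by (auto intro: col_bounded_nonneg)
  let ?N = "\<lambda>z. ((\<odot>) (Z z) ^^ r) (R z)" and ?N' = "\<lambda>z. ((\<odot>) (Z' z) ^^ r) (R z)"
  let ?L = "\<lambda>z a b. (Z z \<odot> (\<lambda>a b. ?N z a b - ?N' z a b)) a b + ((\<lambda>a b. Z z a b - Z' z a b) \<odot> ?N' z) a b"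
  have N: "col_bounded S ?N ((1/4) ^ r * C)" "col_bounded S ?N' ((1/4) ^ r * C)"
    by (intro col_bounded_funpow Z R)+
  have "col_bounded S ?L (1/4 * (4 * \<eta> * C * (1/2) ^ r) + \<eta> * ((1/4) ^ r * C))"
    by (intro col_bounded_add col_bounded_mmult Z D Suc N)
  moreover have "1/4 * (4 * \<eta> * C * (1/2) ^ r) + \<eta> * ((1/4) ^ r * C) \<le> 4 * \<eta> * C * (1/2) ^ Suc r"
  proof -
    have "(1/4) ^ r \<le> (1/2 :: real) ^ r"
      by (rule power_mono) auto
    from mult_left_mono[OF this, of "\<eta> * C"] show ?thesis
      using nn by (simp add: algebra_simps)
  qed
  ultimately have L: "col_bounded S ?L (4 * \<eta> * C * (1/2) ^ Suc r)"
    by (rule col_bounded_le)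
  have eq: "(Z z \<odot> ?N z) a b - (Z' z \<odot> ?N' z) a b = ?L z a b" if "z \<in> S" for z a b
    by (rule mmult_diff) (rule col_bounded_column[OF _ that], fact Z N)+
  then show ?case
    using L unfolding col_bounded_def by (auto cong: continuous_on_cong)
qed

lemma col_bounded_contour_integral:
  assumes "col_bounded (sphere c d) M C" "0 < d"
  shows "(\<lambda>z. M z a b) contour_integrable_on circlepath c d"
    and "l1_bounded (\<lambda>a. contour_integral (circlepath c d) (\<lambda>z. M z a b)) (2 * pi * d * C)"
proof -
  obtain B where B: "\<And>b. l1_bounded (\<lambda>a. B a b) C" 
    "\<And>z a b. z \<in> sphere c d \<Longrightarrow> norm (M z a b) \<le> B a b"
    "\<And>a b. continuous_on (sphere c d) (\<lambda>z. M z a b)"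
    using col_boundedE[OF assms(1)] by blast
  show int: "(\<lambda>z. M z a b) contour_integrable_on circlepath c d" for a
    using B(3) assms(2) by (intro contour_integrable_continuous_circlepath) auto
  have "norm (contour_integral (circlepath c d) (\<lambda>z. M z a b)) \<le> norm ((2 * pi * d) * B a b)" for a
  proof -
    \<comment> \<open>\<open>l1_bounded\<close> controls only the modulus of \<open>B a b\<close>;
      its sign follows because it dominates a norm at some point of the circle.\<close>
    obtain z where "z \<in> sphere c d"
      using assms(2) by (metis all_not_in_conv less_le_not_le sphere_eq_empty)
    then have B0: "0 \<le> B a b"
      using B(2) by (meson norm_ge_zero order_trans)
    have "norm (contour_integral (circlepath c d) (\<lambda>z. M z a b)) \<le> B a b * (2 * pi * d)"
      by (rule has_contour_integral_bound_circlepath[OF has_contour_integral_integral[OF int]])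
         (use B0 B(2) assms(2) in \<open>auto simp: dist_norm norm_minus_commute\<close>)
    then show ?thesis using B0 assms(2) by (simp add: abs_mult mult_ac)
  qed
  moreover have "l1_bounded (\<lambda>a. (2 * pi * d) * B a b) (2 * pi * d * C)"
    using l1_bounded_cmult[OF B(1), of "2 * pi * d"] assms(2) by (simp add: abs_mult)
  ultimately show "l1_bounded (\<lambda>a. contour_integral (circlepath c d) (\<lambda>z. M z a b)) (2 * pi * d * C)"
    by (rule l1_bounded_mono[rotated])
qed

text \<open>The regrouping \<open>(S R' S Y)^r S R' S = S (R' (S Y S))^r R' S\<close>. The weights
  leave the infinite sums as scalars, so they can be moved before anything is known to
  converge.\<close>

lemma funpow_mmult_scale:
  fixes s :: "int ^ 'n \<Rightarrow> complex" and R R' Y :: "'n::finite lmat"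
  assumes R: "\<And>a b. R a b = s a * R' a b * s b"
  shows "((\<odot>) (R \<odot> Y) ^^ r) R a b = s a * ((\<odot>) (R' \<odot> (\<lambda>a b. s a * Y a b * s b)) ^^ r) R' a b * s b"
proof (induction r arbitrary: a b)
  case 0
  show ?case by (simp add: R)
next
  case (Suc r)
  let ?Z = "R' \<odot> (\<lambda>a b. s a * Y a b * s b)"
  let ?N = "((\<odot>) ?Z ^^ r) R'"
  have Z: "(R \<odot> Y) a c * s c = s a * ?Z a c" for a c
    by (simp add: mmult_def R flip: infsum_cmult_left' infsum_cmult_right') (simp add: mult_ac)
  have "(R \<odot> Y) a c * ((\<odot>) (R \<odot> Y) ^^ r) R c b = s a * (?Z a c * ?N c b) * s b" for c
    using Z[of a c] by (simp add: Suc mult.assoc[symmetric])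
  then have "(R \<odot> Y \<odot> ((\<odot>) (R \<odot> Y) ^^ r) R) a b = s a * (?Z \<odot> ?N) a b * s b"
    by (simp only: mmult_def[of "R \<odot> Y"] mmult_def[of ?Z] infsum_cmult_left' infsum_cmult_right')
  then show ?case by simp
qed

lemma infsum_finite_support:
  fixes f :: "'a \<Rightarrow> 'b::{comm_monoid_add, t2_space}"
  assumes "finite S" "\<And>c. c \<notin> S \<Longrightarrow> f c = 0"
  shows "(\<Sum>\<^sub>\<infinity>c. f c) = (\<Sum>c\<in>S. f c)"
proof -
  have "(\<Sum>\<^sub>\<infinity>c. f c) = (\<Sum>\<^sub>\<infinity>c\<in>S. f c)"
    by (rule infsum_cong_neutral) (use assms in auto)
  then show ?thesis using assms(1) by simp
qed

section \<open>Diagonal matrices modified by one two-by-two block\<close>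

definition two_block ::
  "(int ^ 'n \<Rightarrow> complex) \<Rightarrow> int ^ 'n \<Rightarrow> int ^ 'n \<Rightarrow> complex \<Rightarrow> complex \<Rightarrow> 'n::finite lmat" where
  "two_block \<alpha> j j' v v' a b =
     (if a = b then \<alpha> a else if a = j \<and> b = j' then v else if a = j' \<and> b = j then v' else 0)"

lemma infsum_two_block:
  assumes "j \<noteq> j'"
  shows "(\<Sum>\<^sub>\<infinity>b. two_block \<alpha> j j' v v' a b * x b) =
    \<alpha> a * x a + (if a = j then v * x j' else if a = j' then v' * x j else 0)"
proof -
  have "(\<Sum>\<^sub>\<infinity>b. two_block \<alpha> j j' v v' a b * x b) = (\<Sum>b\<in>{a, j, j'}. two_block \<alpha> j j' v v' a b * x b)"
    by (rule infsum_finite_support) (auto simp: two_block_def)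
  also have "\<dots> = \<alpha> a * x a + (if a = j then v * x j' else if a = j' then v' * x j else 0)"
    using assms by (cases "a = j"; cases "a = j'") (auto simp: two_block_def insert_commute)
  finally show ?thesis .
qed

lemma two_block_mmult:
  assumes "j \<noteq> j'"
  shows "(two_block \<alpha> j j' v v' \<odot> M) a b =
    \<alpha> a * M a b + (if a = j then v * M j' b else if a = j' then v' * M j b else 0)"
  unfolding mmult_def using assms by (rule infsum_two_block)

text \<open>Cramer's rule on the block, reciprocals on the remaining diagonal.\<close>

definition two_block_inverse ::
  "(int ^ 'n \<Rightarrow> complex) \<Rightarrow> int ^ 'n \<Rightarrow> int ^ 'n \<Rightarrow> complex \<Rightarrow> complex \<Rightarrow> 'n::finite lmat" where
  "two_block_inverse \<alpha> j j' v v' =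
     (let \<Delta> = \<alpha> j * \<alpha> j' - v * v' in
      two_block (\<lambda>a. if a = j then \<alpha> j' / \<Delta> else if a = j' then \<alpha> j / \<Delta> else 1 / \<alpha> a)
        j j' (- v / \<Delta>) (- v' / \<Delta>))"

text \<open>Each row of a two-block matrix has at most two nonzero entries, so this is a finite
  computation for arbitrary \<open>M\<close>. The third factor is there because products of infinite
  matrices are not associative in general; with it, uniqueness of the inverse follows without
  associativity.\<close>

lemma two_block_inverse_cancel:
  assumes "j \<noteq> j'" and \<Delta>: "\<alpha> j * \<alpha> j' - v * v' \<noteq> 0" and nz: "\<And>a. a \<noteq> j \<Longrightarrow> a \<noteq> j' \<Longrightarrow> \<alpha> a \<noteq> 0"
  shows "two_block_inverse \<alpha> j j' v v' \<odot> (two_block \<alpha> j j' v v' \<odot> M) = M"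
    and "two_block \<alpha> j j' v v' \<odot> (two_block_inverse \<alpha> j j' v v' \<odot> M) = M"
proof -
  define \<Delta> where "\<Delta> = \<alpha> j * \<alpha> j' - v * v'"
  have D: "\<Delta> \<noteq> 0" using \<Delta> by (simp add: \<Delta>_def)
  have 1: "x * (\<alpha> j * \<alpha> j') / \<Delta> - x * (v * v') / \<Delta> = x" for x
    using D by (simp add: diff_divide_distrib[symmetric] right_diff_distrib[symmetric] \<Delta>_def)
  show "two_block_inverse \<alpha> j j' v v' \<odot> (two_block \<alpha> j j' v v' \<odot> M) = M"
  proof (intro ext)
    fix a b
    show "(two_block_inverse \<alpha> j j' v v' \<odot> (two_block \<alpha> j j' v v' \<odot> M)) a b = M a b"
      unfolding two_block_inverse_def Let_def \<Delta>_def[symmetric] two_block_mmult[OF assms(1)]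
      using assms(1) nz[of a] 1[of "M a b"] by (auto simp: field_simps add_divide_distrib)
  qed
  show "two_block \<alpha> j j' v v' \<odot> (two_block_inverse \<alpha> j j' v v' \<odot> M) = M"
  proof (intro ext)
    fix a b
    show "(two_block \<alpha> j j' v v' \<odot> (two_block_inverse \<alpha> j j' v v' \<odot> M)) a b = M a b"
      unfolding two_block_inverse_def Let_def \<Delta>_def[symmetric] two_block_mmult[OF assms(1)]
      using assms(1) nz[of a] 1[of "M a b"] by (auto simp: field_simps)
  qed
qed

lemma two_block_mmult_mone:
  assumes "j \<noteq> j'"
  shows "two_block \<alpha> j j' v v' \<odot> mone = two_block \<alpha> j j' v v'"
  using assms by (auto simp: fun_eq_iff two_block_mmult) (auto simp: mone_def two_block_def)

lemma resolvent_two_block: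
  assumes H: "(\<lambda>a b. H a b - z * mone a b) = two_block \<alpha> j j' v v'"
    and "j \<noteq> j'" "\<alpha> j * \<alpha> j' - v * v' \<noteq> 0" "\<And>a. a \<noteq> j \<Longrightarrow> a \<noteq> j' \<Longrightarrow> \<alpha> a \<noteq> 0"
  shows "resolvent H z = two_block_inverse \<alpha> j j' v v'"
proof -
  let ?A = "two_block \<alpha> j j' v v'" and ?R = "two_block_inverse \<alpha> j j' v v'"
  note cancel = two_block_inverse_cancel[where \<alpha> = \<alpha>, OF assms(2-4)]
  have mone: "?A \<odot> mone = ?A" "?R \<odot> mone = ?R"
    by (simp_all add: two_block_inverse_def Let_def two_block_mmult_mone[OF assms(2)])
  show ?thesis
    unfolding resolvent_def H
  proof (rule the_equality)
    show "?A \<odot> ?R = mone \<and> ?R \<odot> ?A = mone"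
      using cancel[of mone] by (simp add: mone)
  next
    \<comment> \<open>Multiplying \<open>?A \<odot> R = mone\<close> by \<open>?R\<close> from the
      left cancels \<open>?A\<close> and leaves \<open>R = ?R \<odot> mone\<close>.\<close>
    fix R assume "?A \<odot> R = mone \<and> R \<odot> ?A = mone"
    then show "R = ?R"
      using cancel(1)[of R] by (simp add: mone)
  qed
qed

subsection \<open>The perturbation series at a resonant point\<close>

text \<open>\<open>s\<close> is the distance between the two eigenvalues. The off-diagonal entry
  keeps them \<open>2 * w\<close> apart even when \<open>a = a'\<close>, and no diagonal entry is
  farther than \<open>s\<close> from the upper eigenvalue.\<close>

lemma two_by_two_eigenvalue:
  fixes a a' w :: real
  defines "s \<equiv> sqrt (4 * w\<^sup>2 + (a - a')\<^sup>2)"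
  defines "\<kappa> \<equiv> (a + a') / 2 + s / 2"
  assumes w: "0 \<le> w"
  shows "(\<kappa> - a) * (\<kappa> - a') = w\<^sup>2" and "\<bar>\<kappa> - a\<bar> \<le> s" and "\<bar>\<kappa> - a'\<bar> \<le> s" and "2 * w \<le> s"
    and "s = 2 * \<kappa> - a - a'"
proof -
  have s2: "s\<^sup>2 = 4 * w\<^sup>2 + (a - a')\<^sup>2"
    by (simp add: s_def)
  show "(\<kappa> - a) * (\<kappa> - a') = w\<^sup>2"
    using s2 unfolding \<kappa>_def by (simp add: field_simps power2_eq_square)
  have "\<bar>a - a'\<bar> \<le> s"
    unfolding s_def by (rule real_le_rsqrt) simp
  then show "\<bar>\<kappa> - a\<bar> \<le> s" "\<bar>\<kappa> - a'\<bar> \<le> s"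
    unfolding \<kappa>_def by (auto simp: abs_if field_simps split: if_splits)
  show "2 * w \<le> s"
    unfolding s_def by (rule real_le_rsqrt) (simp add: power_mult_distrib)
  show "s = 2 * \<kappa> - a - a'"
    by (simp add: \<kappa>_def field_simps)
qed

text \<open>The circle has radius \<open>d = w / 10\<close> and \<open>20 * d \<le> s\<close>, so
  the determinant is at least \<open>d * (s - d)\<close>, while every entry of the adjugate is at
  most \<open>s + d\<close>. Both grow linearly in \<open>s\<close>; the quotient is thus bounded
  independently of \<open>a\<close> and \<open>a'\<close>, which depend on \<open>k\<close>.\<close>

lemma two_by_two_resolvent_bounds:
  fixes a a' w :: real and z :: complex
  defines "\<kappa> \<equiv> (a + a') / 2 + sqrt (4 * w\<^sup>2 + (a - a')\<^sup>2) / 2"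
  assumes w: "0 < w" and z: "cmod (z - complex_of_real \<kappa>) = w / 10"
  defines "\<Delta> \<equiv> (complex_of_real a - z) * (complex_of_real a' - z) - complex_of_real (w\<^sup>2)"
  shows "\<Delta> \<noteq> 0" and "cmod ((complex_of_real a - z) / \<Delta>) \<le> 20 / w"
    and "cmod ((complex_of_real a' - z) / \<Delta>) \<le> 20 / w" and "w / cmod \<Delta> \<le> 20 / w"
proof -
  define s where "s = sqrt (4 * w\<^sup>2 + (a - a')\<^sup>2)"
  define d where "d = w / 10"
  note ev = two_by_two_eigenvalue[of w a a', folded s_def, folded \<kappa>_def[folded s_def]]
  have sw: "2 * w \<le> s" and s: "s = 2 * \<kappa> - a - a'" and det: "(\<kappa> - a) * (\<kappa> - a') = w\<^sup>2"
    and as: "\<bar>\<kappa> - a\<bar> \<le> s" "\<bar>\<kappa> - a'\<bar> \<le> s"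
    using ev w by auto
  \<comment> \<open>The second eigenvalue is \<open>\<kappa> - s\<close>, and
    \<open>\<Delta>\<close> is the characteristic polynomial split at its two roots.\<close>
  have "\<Delta> = (z - complex_of_real \<kappa>) * (z - complex_of_real \<kappa> + complex_of_real s)"
    unfolding \<Delta>_def det[symmetric] s by (simp add: algebra_simps)
  moreover have "s - d \<le> cmod (z - complex_of_real \<kappa> + complex_of_real s)"
    using norm_diff_ineq[of "complex_of_real s" "z - complex_of_real \<kappa>"] z sw w
    by (simp add: d_def add.commute)
  ultimately have \<Delta>: "d * (s - d) \<le> cmod \<Delta>"
    using mult_left_mono[of "s - d" "cmod (z - complex_of_real \<kappa> + complex_of_real s)" d] w
    by (simp add: norm_mult z[folded d_def]) (simp add: d_def)
  have d: "0 < d" "20 * d \<le> s" "w = 10 * d" using sw w by (auto simp: d_def)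
  then have pos: "0 < d * (s - d)" by simp
  then show "\<Delta> \<noteq> 0" using \<Delta> by auto
  have le: "x / cmod \<Delta> \<le> 20 / w" if "0 \<le> x" "x \<le> s + d" for x
  proof -
    have "x / cmod \<Delta> \<le> (s + d) / (d * (s - d))"
      using that \<Delta> pos by (intro frac_le) auto
    also have "\<dots> \<le> 2 / d"
      using d by (simp add: field_simps)
    finally show ?thesis using d by simp
  qed
  have "cmod (complex_of_real b - z) \<le> s + d" if "\<bar>\<kappa> - b\<bar> \<le> s" for b
  proof -
    have "complex_of_real b - z = complex_of_real (b - \<kappa>) - (z - complex_of_real \<kappa>)"
      by simp
    then have "cmod (complex_of_real b - z) \<le> \<bar>b - \<kappa>\<bar> + d"
      using norm_triangle_ineq4[of "complex_of_real (b - \<kappa>)" "z - complex_of_real \<kappa>"] z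
      by (simp only: d_def norm_of_real)
    then show ?thesis using that by linarith
  qed
  with as show "cmod ((complex_of_real a - z) / \<Delta>) \<le> 20 / w"
      "cmod ((complex_of_real a' - z) / \<Delta>) \<le> 20 / w"
    by (auto simp: norm_divide intro!: le)
  show "w / cmod \<Delta> \<le> 20 / w"
    using w d by (intro le) auto
qed

text \<open>Two block rows contribute at most 2 over the radius each; the summand 2 is for a
  nonresonant diagonal entry after weighting.\<close>

definition resolvent_const :: "(real ^ 'n \<Rightarrow> real) \<Rightarrow> int ^ 'n \<Rightarrow> real" where
  "resolvent_const V q = 4 / contour_radius V q + 2"

text \<open>The 2 bounds a column of the unperturbed projection, the other summand dominates the
  perturbation series.\<close>

definition column_const :: "(real ^ 'n \<Rightarrow> real) \<Rightarrow> int ^ 'n \<Rightarrow> real" where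
  "column_const V q = 2 + contour_radius V q * resolvent_const V q"

text \<open>The sum over the orders \<open>r \<ge> 1\<close> of the bounds from
  \<open>col_bounded_funpow_diff\<close>, integrated along the circle.\<close>

definition lipschitz_const :: "(real ^ 'n \<Rightarrow> real) \<Rightarrow> int ^ 'n \<Rightarrow> real" where
  "lipschitz_const V q = 4 * contour_radius V q * (resolvent_const V q)\<^sup>2"

text \<open>With \<open>\<tau> = k powr (- \<gamma>)\<close> the last assumption is the lower bound on the contour for the
  nonresonant indices, weakened from \<open>\<gamma>\<^sub>1\<close> to \<open>\<gamma>\<close>.\<close>

locale resonant_point =
  fixes l :: nat and V :: "real ^ 'n \<Rightarrow> real" and q j :: "int ^ 'n" and t :: "real ^ 'n"
    and \<tau> K :: real
  assumes V: "has_fourier_series V (fourier_coeff V)"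
    and K: "l1_bounded (fourier_coeff V) K"
    and V0: "fourier_coeff V 0 = 0"
    and q: "q \<noteq> 0" and vq: "fourier_coeff V q \<noteq> 0"
    and \<tau>: "0 < \<tau>" "\<tau> \<le> 1"
    and gap: "\<And>z m. z \<in> sphere (complex_of_real (lambda_plus l V q j t)) (contour_radius V q) \<Longrightarrow>
      m \<noteq> j \<Longrightarrow> m \<noteq> j - q \<Longrightarrow> 1 \<le> 2 * \<tau>\<^sup>2 * cmod (complex_of_real (p m t ^ (2 * l)) - z)"
begin

abbreviation "v \<equiv> fourier_coeff V"
abbreviation "d \<equiv> contour_radius V q"
abbreviation "\<Lambda> \<equiv> complex_of_real (lambda_plus l V q j t)"
abbreviation "\<Gamma> \<equiv> sphere \<Lambda> d"

lemma d_pos: "0 < d"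
  using vq by (simp add: contour_radius_def)

lemma block_distinct: "j \<noteq> j - q"
  using q by simp

lemma v_cnj: "v q * v (- q) = complex_of_real ((cmod (v q))\<^sup>2)"
  by (simp add: fourier_coeff_cnj complex_norm_square del: of_real_power)

lemma block_V: "(Pq q j \<odot> mult_op V \<odot> Pq q j) a b =
    (if a \<in> {j, j - q} \<and> b \<in> {j, j - q} then v (a - b) else 0)"
proof -
  have *: "(Pq q j \<odot> mult_op V) a c = (if a \<in> {j, j - q} then v (a - c) else 0)" for c
    unfolding mmult_def
    by (subst infsum_finite_support[where S = "{a}"]) (auto simp: Pq_def mult_op_def)
  show ?thesis
    unfolding mmult_def[of "Pq q j \<odot> mult_op V"] *
    by (subst infsum_finite_support[where S = "{b}"]) (auto simp: Pq_def)
qed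

text \<open>Since \<open>V\<close> has mean zero, compressing it to the block leaves the diagonal
  alone and adds just the two entries \<open>v q\<close> and \<open>v (- q)\<close>.\<close>

lemma H_hat_shift:
  "(\<lambda>a b. H_hat l V q j t a b - z * mone a b) =
    two_block (\<lambda>a. complex_of_real (p a t ^ (2 * l)) - z) j (j - q) (v q) (v (- q))"
  using q V0 by (auto simp: fun_eq_iff H_hat_def block_V H0_def mone_def two_block_def)

lemma H_hat_two_block:
  "H_hat l V q j t = two_block (\<lambda>a. complex_of_real (p a t ^ (2 * l))) j (j - q) (v q) (v (- q))"
  using H_hat_shift[of 0] by simp

abbreviation "\<mu> a \<equiv> complex_of_real (p a t ^ (2 * l))"
abbreviation "\<Delta> z \<equiv> (\<mu> j - z) * (\<mu> (j - q) - z) - v q * v (- q)"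

lemma block_bounds:
  assumes "z \<in> \<Gamma>"
  shows "\<Delta> z \<noteq> 0" and "cmod ((\<mu> j - z) / \<Delta> z) \<le> 2 / d" and "cmod ((\<mu> (j - q) - z) / \<Delta> z) \<le> 2 / d"
    and "cmod (v q / \<Delta> z) \<le> 2 / d" and "cmod (v (- q) / \<Delta> z) \<le> 2 / d"
proof -
  have d: "2 / d = 20 / cmod (v q)"
    by (simp add: contour_radius_def)
  have "cmod (z - complex_of_real ((p j t ^ (2 * l) + p (j - q) t ^ (2 * l)) / 2 +
      sqrt (4 * (cmod (v q))\<^sup>2 + (p j t ^ (2 * l) - p (j - q) t ^ (2 * l))\<^sup>2) / 2)) = cmod (v q) / 10"
    using assms by (simp add: lambda_plus_def contour_radius_def dist_norm norm_minus_commute)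
  note b = two_by_two_resolvent_bounds[OF _ this, folded v_cnj]
  show "\<Delta> z \<noteq> 0" "cmod ((\<mu> j - z) / \<Delta> z) \<le> 2 / d" "cmod ((\<mu> (j - q) - z) / \<Delta> z) \<le> 2 / d"
    "cmod (v q / \<Delta> z) \<le> 2 / d" "cmod (v (- q) / \<Delta> z) \<le> 2 / d"
    unfolding d using b vq by (auto simp: norm_divide fourier_coeff_cnj)
qed

lemma resolvent_eq:
  assumes "z \<in> \<Gamma>"
  shows "resolvent (H_hat l V q j t) z =
    two_block_inverse (\<lambda>a. \<mu> a - z) j (j - q) (v q) (v (- q))"
proof (rule resolvent_two_block[OF H_hat_shift block_distinct])
  show "\<mu> a - z \<noteq> 0" if "a \<noteq> j" "a \<noteq> j - q" for a
    using gap[OF assms that] by auto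
qed (fact block_bounds(1)[OF assms])

section \<open>The weighted resolvent and the perturbation series\<close>

definition weight :: "int ^ 'n \<Rightarrow> complex" where
  "weight a = (if a \<in> {j, j - q} then 1 else complex_of_real \<tau>)"

definition scaled_resolvent :: "complex \<Rightarrow> 'n lmat" where
  "scaled_resolvent z a b = resolvent (H_hat l V q j t) z a b / (weight a * weight b)"

abbreviation "C\<^sub>R \<equiv> resolvent_const V q"

lemma weight_nonzero: "weight a \<noteq> 0"
  using \<tau> by (simp add: weight_def)

lemma norm_weight_le: "norm (weight a) \<le> 1"
  using \<tau> by (simp add: weight_def)

lemma resolvent_scaled:
  "resolvent (H_hat l V q j t) z a b = weight a * scaled_resolvent z a b * weight b"
  by (simp add: scaled_resolvent_def weight_nonzero)

lemma C\<^sub>R_pos: "0 < C\<^sub>R"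
  using d_pos by (simp add: resolvent_const_def add_pos_pos)

lemma col_bounded_scaled_resolvent: "col_bounded \<Gamma> scaled_resolvent C\<^sub>R"
proof (rule col_boundedI)
  \<comment> \<open>Block rows carry \<open>2 / d\<close> in every column and every diagonal entry
    carries 2. This overestimates, but gives one formula for resonant and nonresonant
    columns.\<close>
  let ?B = "\<lambda>a b. (if a \<in> {j, j - q} then 2 / d else 0) + (if a = b then 2 else 0 :: real)"
  show "l1_bounded (\<lambda>a. ?B a b) C\<^sub>R" for b
    unfolding resolvent_const_def
  proof (rule l1_bounded_add)
    show "l1_bounded (\<lambda>a. if a \<in> {j, j - q} then 2 / d else 0) (4 / d)"
      using d_pos block_distinct by (intro l1_bounded_finite_support[where S = "{j, j - q}"]) auto
    show "l1_bounded (\<lambda>a. if a = b then 2 else 0 :: real) 2"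
      by (intro l1_bounded_finite_support[where S = "{b}"]) auto
  qed
  show "norm (scaled_resolvent z a b) \<le> ?B a b" if z: "z \<in> \<Gamma>" for z a b
  proof (cases "a = b \<and> a \<notin> {j, j - q}")
    case True
    then have a: "a = b" "a \<noteq> j" "a \<noteq> j - q" by auto
    have g: "1 \<le> 2 * \<tau>\<^sup>2 * cmod (\<mu> a - z)"
      using gap[OF z, of a] a by auto
    then have "0 < cmod (\<mu> a - z)"
      by (cases "\<mu> a = z") auto
    moreover have "cmod (scaled_resolvent z a b) = 1 / (\<tau>\<^sup>2 * cmod (\<mu> a - z))"
      using a \<tau> unfolding scaled_resolvent_def resolvent_eq[OF z] two_block_inverse_def Let_def two_block_def
      by (simp add: norm_divide norm_mult weight_def power2_eq_square)
    ultimately have "cmod (scaled_resolvent z a b) \<le> 2"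
      using \<tau> g by (simp add: divide_le_eq mult.assoc)
    then show ?thesis using a by simp
  next
    case False
    then show ?thesis
      using block_bounds[OF z] d_pos block_distinct
      unfolding scaled_resolvent_def resolvent_eq[OF z] two_block_inverse_def Let_def two_block_def
      by (auto simp: weight_def)
  qed
  show "continuous_on \<Gamma> (\<lambda>z. scaled_resolvent z a b)" for a b
  proof -
    have "\<mu> a - z \<noteq> 0" if "z \<in> \<Gamma>" "a \<noteq> j" "a \<noteq> j - q" for z a
      using gap[OF that] by auto
    then have "continuous_on \<Gamma> (\<lambda>z. two_block_inverse (\<lambda>a. \<mu> a - z) j (j - q) (v q) (v (- q)) a b
        / (weight a * weight b))"
      using block_bounds(1) q unfolding two_block_inverse_def Let_def two_block_def
      by (cases "a = b"; cases "a = j"; cases "a = j - q"; cases "b = j"; cases "b = j - q")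
        (auto intro!: continuous_intros simp: weight_nonzero)
    then show ?thesis
      by (rule continuous_on_eq) (simp add: scaled_resolvent_def resolvent_eq)
  qed
qed

lemma Y_op_scaled:
  assumes "has_fourier_series W w" "l1_bounded (\<lambda>m. w m - v m) \<eta>"
  shows "l1_bounded (\<lambda>a. weight a * Y_op V q j W a b * weight b) (\<eta> + \<tau> * K)"
proof (rule l1_bounded_mono)
  let ?g = "\<lambda>a. norm (w (a - b) - v (a - b)) + norm (complex_of_real \<tau> * v (a - b))"
  have inj: "inj (\<lambda>a. a - b)" by (auto simp: inj_def)
  have "l1_bounded (\<lambda>a. norm (w (a - b) - v (a - b))) \<eta>"
    using l1_bounded_reindex[OF assms(2) inj] by (simp add: l1_bounded_def)
  moreover have "l1_bounded (\<lambda>a. norm (complex_of_real \<tau> * v (a - b))) (\<tau> * K)"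
    using l1_bounded_cmult[OF l1_bounded_reindex[OF K inj], of "complex_of_real \<tau>"] \<tau>
    by (simp add: l1_bounded_def)
  ultimately show "l1_bounded ?g (\<eta> + \<tau> * K)"
    by (rule l1_bounded_add)
  show "norm (weight a * Y_op V q j W a b * weight b) \<le> norm (?g a)" for a
  proof -
    let ?x = "norm (w (a - b) - v (a - b))" and ?y = "norm (v (a - b))"
    have Y: "Y_op V q j W a b = w (a - b) - (if a \<in> {j, j - q} \<and> b \<in> {j, j - q} then v (a - b) else 0)"
      by (simp add: Y_op_def block_V mult_op_def has_fourier_series_fourier_coeff[OF assms(1)])
    have tri: "norm (w (a - b)) \<le> ?x + ?y"
      using norm_triangle_ineq[of "w (a - b) - v (a - b)" "v (a - b)"] by simp
    have "norm (weight a * Y_op V q j W a b * weight b) \<le> ?x + \<tau> * ?y"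
    proof (cases "a \<in> {j, j - q} \<and> b \<in> {j, j - q}")
      case True
      then show ?thesis using \<tau> unfolding Y by (auto simp: weight_def)
    next
      case False
      \<comment> \<open>One of the two indices is nonresonant. If the other lies in the block only a
        single factor \<open>\<tau>\<close> is gained, which fixes the rate of the whole
        scheme.\<close>
      have "norm (weight a) * norm (weight b) \<le> \<tau>"
        using False \<tau> by (auto simp: weight_def mult_le_one mult_left_le_one_le)
      then have "norm (weight a * Y_op V q j W a b * weight b) \<le> \<tau> * norm (w (a - b))"
        using False mult_right_mono[of "norm (weight a) * norm (weight b)" \<tau> "norm (w (a - b))"]
        unfolding Y by (auto simp: norm_mult mult_ac)
      also have "\<dots> \<le> \<tau> * (?x + ?y)"
        using tri \<tau> by (intro mult_left_mono) auto
      also have "\<dots> \<le> ?x + \<tau> * ?y"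
        using \<tau> by (simp add: distrib_left mult_left_le_one_le)
      finally show ?thesis .
    qed
    then show ?thesis using \<tau> by (simp add: norm_mult)
  qed
qed

definition scaled_step :: "(real ^ 'n \<Rightarrow> real) \<Rightarrow> complex \<Rightarrow> 'n lmat" where
  "scaled_step W z = scaled_resolvent z \<odot> (\<lambda>a b. weight a * Y_op V q j W a b * weight b)"

lemma col_bounded_scaled_step:
  assumes "has_fourier_series W w" "l1_bounded (\<lambda>m. w m - v m) \<eta>"
  shows "col_bounded \<Gamma> (scaled_step W) (C\<^sub>R * (\<eta> + \<tau> * K))"
  unfolding scaled_step_def[abs_def]
  by (intro col_bounded_mmult col_bounded_scaled_resolvent col_bounded_const Y_op_scaled[OF assms])

text \<open>The subtracted block of \<open>V\<close> is common to both operators, so the difference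
  is linear in \<open>W - W'\<close>; the weights have modulus at most one.\<close>

lemma col_bounded_scaled_step_diff:
  assumes W: "has_fourier_series W w" and W': "has_fourier_series W' w'"
    and le: "l1_bounded (\<lambda>m. w m - w' m) \<rho>"
  shows "col_bounded \<Gamma> (\<lambda>z a b. scaled_step W z a b - scaled_step W' z a b) (C\<^sub>R * \<rho>)"
proof -
  let ?Y = "\<lambda>W a b. weight a * Y_op V q j W a b * weight b"
  let ?D = "\<lambda>a b. ?Y W a b - ?Y W' a b"
  \<comment> \<open>Only finiteness of these two bounds matters: it justifies splitting the infinite
    sums in \<open>mmult_diff\<close>.\<close>
  obtain \<eta> \<eta>' where \<eta>: "l1_bounded (\<lambda>m. w m - v m) \<eta>" "l1_bounded (\<lambda>m. w' m - v m) \<eta>'"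
  proof
    have "l1_bounded w (\<Sum>\<^sub>\<infinity>m. norm (w m))" "l1_bounded w' (\<Sum>\<^sub>\<infinity>m. norm (w' m))"
      using W W' by (auto simp: has_fourier_series_def l1_bounded_iff)
    from l1_bounded_diff[OF this(1) K] l1_bounded_diff[OF this(2) K]
    show "l1_bounded (\<lambda>m. w m - v m) ((\<Sum>\<^sub>\<infinity>m. norm (w m)) + K)"
      "l1_bounded (\<lambda>m. w' m - v m) ((\<Sum>\<^sub>\<infinity>m. norm (w' m)) + K)" .
  qed
  have "l1_bounded (\<lambda>a. ?D a b) \<rho>" for b
  proof (rule l1_bounded_mono)
    show "l1_bounded (\<lambda>a. w (a - b) - w' (a - b)) \<rho>"
      by (rule l1_bounded_reindex[OF le]) (auto simp: inj_def)
    fix a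
    have "?D a b = weight a * weight b * (w (a - b) - w' (a - b))"
      by (simp add: Y_op_def mult_op_def has_fourier_series_fourier_coeff[OF W]
          has_fourier_series_fourier_coeff[OF W'] algebra_simps)
    moreover have "norm (weight a) * norm (weight b) \<le> 1"
      by (intro mult_le_one norm_weight_le norm_ge_zero)
    ultimately show "norm (?D a b) \<le> norm (w (a - b) - w' (a - b))"
      by (simp add: norm_mult mult_left_le_one_le)
  qed
  then have D: "col_bounded \<Gamma> (\<lambda>z. scaled_resolvent z \<odot> ?D) (C\<^sub>R * \<rho>)"
    by (intro col_bounded_mmult col_bounded_scaled_resolvent col_bounded_const)
  have eq: "scaled_step W z a b - scaled_step W' z a b = (scaled_resolvent z \<odot> ?D) a b"
    if "z \<in> \<Gamma>" for z a b
  proof -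
    have "scaled_step W z a b - scaled_step W' z a b = (scaled_resolvent z \<odot> ?D) a b +
        ((\<lambda>a b. scaled_resolvent z a b - scaled_resolvent z a b) \<odot> ?Y W') a b"
      unfolding scaled_step_def
      by (rule mmult_diff)
         (rule col_bounded_column[OF col_bounded_scaled_resolvent that]
           Y_op_scaled[OF W \<eta>(1)] Y_op_scaled[OF W' \<eta>(2)])+
    then show ?thesis by (simp add: mmult_def)
  qed
  show ?thesis
    by (rule col_bounded_cong[OF _ D]) (simp add: eq)
qed

definition perturbation_term :: "(real ^ 'n \<Rightarrow> real) \<Rightarrow> nat \<Rightarrow> complex \<Rightarrow> 'n lmat" where
  "perturbation_term W r z a b =
     weight a * weight b * ((\<odot>) (scaled_step W z) ^^ r) (scaled_resolvent z) a b"

lemma G_hat_eq: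
  "G_hat l V q j t W r a b = (- 1) ^ (r + 1) / (2 * complex_of_real pi * \<i>) *
     contour_integral (circlepath \<Lambda> d) (\<lambda>z. perturbation_term W r z a b)"
proof -
  have "((\<odot>) (resolvent (H_hat l V q j t) z \<odot> Y_op V q j W) ^^ r) (resolvent (H_hat l V q j t) z) a b =
      perturbation_term W r z a b" for z
    unfolding funpow_mmult_scale[where s = weight and R' = "scaled_resolvent z", OF resolvent_scaled]
    by (simp add: perturbation_term_def scaled_step_def)
  then show ?thesis by (simp add: G_hat_def Let_def)
qed

lemma norm_contour_factor: "norm ((- 1) ^ (r + 1) / (2 * complex_of_real pi * \<i>)) = 1 / (2 * pi)"
  by (simp add: norm_divide norm_mult norm_power)

lemma contour_normalisation: "1 / (2 * pi) * (2 * pi * d * x) = d * x"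
  by simp

text \<open>The outer weights are estimated by one, and the prefactor turns the circumference of the
  circle into \<open>d\<close>.\<close>

lemma G_hat_bound:
  assumes Z: "col_bounded \<Gamma> (scaled_step W) (1 / 4)"
  shows "l1_bounded (\<lambda>a. G_hat l V q j t W r a b) (d * ((1 / 4) ^ r * C\<^sub>R))"
    and "(\<lambda>z. perturbation_term W r z a b) contour_integrable_on circlepath \<Lambda> d"
proof -
  have *: "col_bounded \<Gamma> (perturbation_term W r) ((1 / 4) ^ r * C\<^sub>R)"
    unfolding perturbation_term_def[abs_def]
    by (intro col_bounded_scale col_bounded_funpow Z col_bounded_scaled_resolvent)
       (simp add: norm_mult mult_le_one norm_weight_le)
  show "(\<lambda>z. perturbation_term W r z a b) contour_integrable_on circlepath \<Lambda> d"
    by (rule col_bounded_contour_integral(1)[OF * d_pos])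
  show "l1_bounded (\<lambda>a. G_hat l V q j t W r a b) (d * ((1 / 4) ^ r * C\<^sub>R))"
    using l1_bounded_cmult[OF col_bounded_contour_integral(2)[OF * d_pos],
        of "(- 1) ^ (r + 1) / (2 * complex_of_real pi * \<i>)" b]
    unfolding norm_contour_factor G_hat_eq[symmetric] contour_normalisation .
qed

lemma G_hat_diff_bound:
  assumes Z: "col_bounded \<Gamma> (scaled_step W) (1 / 4)" "col_bounded \<Gamma> (scaled_step W') (1 / 4)"
    and W: "has_fourier_series W w" "has_fourier_series W' w'" "l1_bounded (\<lambda>m. w m - w' m) \<rho>"
  shows "l1_bounded (\<lambda>a. G_hat l V q j t W r a b - G_hat l V q j t W' r a b)
    (d * (4 * (C\<^sub>R * \<rho>) * C\<^sub>R * (1 / 2) ^ r))"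
proof -
  let ?D = "\<lambda>z a b. perturbation_term W r z a b - perturbation_term W' r z a b"
  have *: "col_bounded \<Gamma> ?D (4 * (C\<^sub>R * \<rho>) * C\<^sub>R * (1 / 2) ^ r)"
    unfolding perturbation_term_def right_diff_distrib[symmetric]
    by (intro col_bounded_scale col_bounded_funpow_diff Z col_bounded_scaled_resolvent
        col_bounded_scaled_step_diff[OF W])
       (simp add: norm_mult mult_le_one norm_weight_le)
  have "contour_integral (circlepath \<Lambda> d) (\<lambda>z. ?D z a b) =
      contour_integral (circlepath \<Lambda> d) (\<lambda>z. perturbation_term W r z a b) -
      contour_integral (circlepath \<Lambda> d) (\<lambda>z. perturbation_term W' r z a b)" for a
    by (rule contour_integral_diff) (rule G_hat_bound Z)+
  then have eq: "(- 1) ^ (r + 1) / (2 * complex_of_real pi * \<i>) *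
      contour_integral (circlepath \<Lambda> d) (\<lambda>z. ?D z a b) =
      G_hat l V q j t W r a b - G_hat l V q j t W' r a b" for a
    by (simp only: G_hat_eq right_diff_distrib)
  show ?thesis
    using l1_bounded_cmult[OF col_bounded_contour_integral(2)[OF * d_pos],
        of "(- 1) ^ (r + 1) / (2 * complex_of_real pi * \<i>)" b]
    unfolding norm_contour_factor eq contour_normalisation .
qed

text \<open>\<open>E_hat\<close> is a definite description, so a unit eigenvector has to be
  exhibited and the projection shown independent of its choice. A column then has two possibly
  nonzero entries, each of modulus at most one.\<close>

lemma E_hat_bound: "l1_bounded (\<lambda>a. E_hat l V q j t a b) 2"
proof -
  let ?j = "j - q"
  \<comment> \<open>The ratio of the two components of an eigenvector, read off row \<open>j\<close>
    of the eigenvalue equation.\<close>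
  define \<nu> where "\<nu> = (\<Lambda> - \<mu> j) / v q"
  define w0 where "w0 a = (if a = j then 1 else if a = ?j then \<nu> else 0)" for a
  define N where "N = 1 + (cmod \<nu>)\<^sup>2"
  define w where "w a = w0 a / complex_of_real (sqrt N)" for a
  have N: "0 < N" by (simp add: N_def add_pos_nonneg)
  have sqrtN: "complex_of_real (sqrt N) * complex_of_real (sqrt N) = complex_of_real N"
    using N by (simp flip: of_real_mult)
  have "(lambda_plus l V q j t - p j t ^ (2 * l)) * (lambda_plus l V q j t - p ?j t ^ (2 * l)) =
      (cmod (v q))\<^sup>2"
    using two_by_two_eigenvalue(1)[of "cmod (v q)" "p j t ^ (2 * l)" "p ?j t ^ (2 * l)"]
    by (simp add: lambda_plus_def)
  then have ev: "(\<Lambda> - \<mu> j) * (\<Lambda> - \<mu> ?j) = v q * v (- q)"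
    unfolding v_cnj by (metis of_real_diff of_real_mult)
  have H: "(\<Sum>\<^sub>\<infinity>b. H_hat l V q j t a b * e b) =
      \<mu> a * e a + (if a = j then v q * e ?j else if a = ?j then v (- q) * e j else 0)" for a e
    unfolding H_hat_two_block by (rule infsum_two_block[OF block_distinct])
  have eigen: "(\<forall>a. (\<Sum>\<^sub>\<infinity>b. H_hat l V q j t a b * e b) = \<Lambda> * e a) \<longleftrightarrow> e ?j = \<nu> * e j"
    if "\<And>a. a \<notin> {j, ?j} \<Longrightarrow> e a = 0" for e
  proof
    assume "\<forall>a. (\<Sum>\<^sub>\<infinity>b. H_hat l V q j t a b * e b) = \<Lambda> * e a"
    then have "\<mu> j * e j + v q * e ?j = \<Lambda> * e j"
      using H[of j e] by simp
    then show "e ?j = \<nu> * e j"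
      using vq by (simp add: \<nu>_def field_simps)
  next
    assume e: "e ?j = \<nu> * e j"
    have "\<mu> j * e j + v q * e ?j = \<Lambda> * e j"
      unfolding e using vq by (simp add: \<nu>_def field_simps)
    \<comment> \<open>Row \<open>j - q\<close> follows from row \<open>j\<close> through the
      characteristic equation \<open>ev\<close>.\<close>
    moreover have "(\<Lambda> - \<mu> ?j) * \<nu> = (\<Lambda> - \<mu> j) * (\<Lambda> - \<mu> ?j) / v q"
      by (simp only: \<nu>_def times_divide_eq_right mult.commute)
    then have "(\<Lambda> - \<mu> ?j) * \<nu> = v (- q)"
      unfolding ev using vq by simp
    then have "v (- q) * e j = (\<Lambda> - \<mu> ?j) * e ?j"
      unfolding e by (simp only: mult.assoc[symmetric])
    then have "\<mu> ?j * e ?j + v (- q) * e j = \<Lambda> * e ?j"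
      by (simp add: left_diff_distrib)
    ultimately show "\<forall>a. (\<Sum>\<^sub>\<infinity>b. H_hat l V q j t a b * e b) = \<Lambda> * e a"
      unfolding H using that block_distinct by auto
  qed
  have "E_hat l V q j t = (\<lambda>a b. w a * cnj (w b))"
    unfolding E_hat_def
  proof (rule the_equality)
    have "w a = 0" if "a \<notin> {j, ?j}" for a using that by (auto simp: w_def w0_def)
    moreover have "(\<Sum>a\<in>{j, ?j}. (cmod (w a))\<^sup>2) = 1"
      using block_distinct N
      by (simp add: w_def w0_def norm_divide power_divide N_def flip: add_divide_distrib)
    moreover have "w ?j = \<nu> * w j"
      using block_distinct by (simp add: w_def w0_def)
    ultimately show "\<exists>e. (\<forall>a. a \<notin> {j, ?j} \<longrightarrow> e a = 0) \<and> (\<Sum>a\<in>{j, ?j}. (cmod (e a))\<^sup>2) = 1 \<and>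
        (\<forall>a. (\<Sum>\<^sub>\<infinity>b. H_hat l V q j t a b * e b) = \<Lambda> * e a) \<and>
        (\<lambda>a b. w a * cnj (w b)) = (\<lambda>a b. e a * cnj (e b))"
      using eigen[of w] by (intro exI[of _ w]) blast
  next
    fix E assume "\<exists>e. (\<forall>a. a \<notin> {j, ?j} \<longrightarrow> e a = 0) \<and> (\<Sum>a\<in>{j, ?j}. (cmod (e a))\<^sup>2) = 1 \<and>
        (\<forall>a. (\<Sum>\<^sub>\<infinity>b. H_hat l V q j t a b * e b) = \<Lambda> * e a) \<and> E = (\<lambda>a b. e a * cnj (e b))"
    then obtain e where e0: "\<And>a. a \<notin> {j, ?j} \<Longrightarrow> e a = 0"
      and e1: "(\<Sum>a\<in>{j, ?j}. (cmod (e a))\<^sup>2) = 1"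
      and e3: "\<forall>a. (\<Sum>\<^sub>\<infinity>b. H_hat l V q j t a b * e b) = \<Lambda> * e a"
      and E: "E = (\<lambda>a b. e a * cnj (e b))"
      by blast
    have e2: "e ?j = \<nu> * e j"
      using eigen[of e] e0 e3 by blast
    have e: "e a = e j * w0 a" for a
      using e0[of a] e2 by (auto simp: w0_def)
    \<comment> \<open>Normalisation determines \<open>e j\<close> up to a phase, and the phase
      cancels in \<open>e a * cnj (e b)\<close>.\<close>
    have "(cmod (e j))\<^sup>2 * N = 1"
      using e1 e2 block_distinct by (simp add: N_def norm_mult power_mult_distrib algebra_simps)
    then have "e j * cnj (e j) * complex_of_real N = 1"
      by (metis complex_norm_square of_real_1 of_real_mult)
    then have ee: "e j * cnj (e j) = 1 / complex_of_real N"
      using N by (simp add: field_simps)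
    show "E = (\<lambda>a b. w a * cnj (w b))"
    proof (intro ext)
      fix a b
      have "E a b = e j * cnj (e j) * (w0 a * cnj (w0 b))"
        unfolding E e[of a] e[of b] by (simp add: mult_ac)
      also have "\<dots> = w a * cnj (w b)"
        by (simp add: ee w_def sqrtN)
      finally show "E a b = w a * cnj (w b)" .
    qed
  qed
  moreover have "norm (w a * cnj (w b)) \<le> 1" for a b
  proof -
    have "norm (w0 a) \<le> sqrt N" for a
      by (auto simp: w0_def N_def real_le_rsqrt)
    then have "norm (w a) \<le> 1" for a
      using N by (simp add: w_def norm_divide)
    then show ?thesis by (simp add: norm_mult mult_le_one)
  qed
  from add_mono[OF this this] have "norm (w j * cnj (w b)) + norm (w ?j * cnj (w b)) \<le> 2"
    by simp
  moreover have "w a = 0" if "a \<notin> {j, ?j}" for a using that by (auto simp: w_def w0_def)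
  ultimately show ?thesis
    using block_distinct by (intro l1_bounded_finite_support[where S = "{j, ?j}"]) auto
qed

abbreviation "U \<equiv> column_const V q"
abbreviation "L \<equiv> lipschitz_const V q"

lemma E_pert_bound:
  assumes Z: "col_bounded \<Gamma> (scaled_step W) (1 / 4)"
  shows "summable (\<lambda>r. G_hat l V q j t W (Suc r) a b)"
    and "l1_bounded (\<lambda>a. E_pert l V q j t W a b) U"
proof -
  \<comment> \<open>The series starts at order one, so the powers of \<open>1/4\<close> sum to
    \<open>1/3\<close>.\<close>
  have K: "(\<lambda>r. d * ((1 / 4) ^ Suc r * C\<^sub>R)) sums (d * C\<^sub>R / 3)"
    using sums_mult[OF geometric_sums[of "1 / 4 :: real"], of "d * C\<^sub>R / 4"] by (simp add: mult_ac)
  show "summable (\<lambda>r. G_hat l V q j t W (Suc r) a b)"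
    by (rule l1_bounded_suminf(1)[OF G_hat_bound(1)[OF Z] sums_summable[OF K]])
  have "l1_bounded (\<lambda>a. \<Sum>r. G_hat l V q j t W (Suc r) a b) (d * C\<^sub>R / 3)"
    using l1_bounded_suminf(2)[where g = "\<lambda>r a. G_hat l V q j t W (Suc r) a b",
        OF G_hat_bound(1)[OF Z] sums_summable[OF K]]
    unfolding sums_unique[OF K, symmetric] .
  from l1_bounded_add[OF E_hat_bound this]
  have "l1_bounded (\<lambda>a. E_hat l V q j t a b + (\<Sum>r. G_hat l V q j t W (Suc r) a b)) (2 + d * C\<^sub>R / 3)" .
  moreover have "2 + d * C\<^sub>R / 3 \<le> U"
    using d_pos C\<^sub>R_pos by (simp add: column_const_def)
  ultimately show "l1_bounded (\<lambda>a. E_pert l V q j t W a b) U"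
    unfolding E_pert_def by (rule l1_bounded_le)
qed

lemma E_pert_diff_bound:
  assumes Z: "col_bounded \<Gamma> (scaled_step W) (1 / 4)" "col_bounded \<Gamma> (scaled_step W') (1 / 4)"
    and W: "has_fourier_series W w" "has_fourier_series W' w'" "l1_bounded (\<lambda>m. w m - w' m) \<rho>"
  shows "l1_bounded (\<lambda>a. E_pert l V q j t W a b - E_pert l V q j t W' a b) (L * \<rho>)"
proof -
  \<comment> \<open>The unperturbed projection is the same for both potentials and cancels; from
    order one on, the powers of \<open>1/2\<close> sum to one.\<close>
  have K: "(\<lambda>r. d * (4 * (C\<^sub>R * \<rho>) * C\<^sub>R * (1 / 2) ^ Suc r)) sums (L * \<rho>)"
    using sums_mult[OF geometric_sums[of "1 / 2 :: real"], of "2 * d * C\<^sub>R * C\<^sub>R * \<rho>"]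
    by (simp add: lipschitz_const_def power2_eq_square mult_ac)
  have "l1_bounded (\<lambda>a. \<Sum>r. G_hat l V q j t W (Suc r) a b - G_hat l V q j t W' (Suc r) a b) (L * \<rho>)"
    using l1_bounded_suminf(2)[OF G_hat_diff_bound[OF Z W] sums_summable[OF K]] K
    by (simp add: sums_iff)
  then show ?thesis
    by (simp add: E_pert_def suminf_diff[OF E_pert_bound(1)[OF Z(1)] E_pert_bound(1)[OF Z(2)]])
qed

lemma expansion_converges_scaled_step:
  assumes "col_bounded \<Gamma> (scaled_step W) (1 / 4)"
  shows "expansion_converges l V q j t W"
  unfolding expansion_converges_def
  by (intro conjI allI E_pert_bound(1)[OF assms] l1_bounded_summable[OF E_pert_bound(2)[OF assms]])

text \<open>The quasi-periodic factor \<open>cis (t \<bullet> x)\<close> has modulus one and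
  disappears from \<open>|u|^2\<close>, which is therefore periodic with the autocorrelation as
  coefficients.\<close>

lemma M_plus_fourier_series:
  assumes Z: "col_bounded \<Gamma> (scaled_step W) (1 / 4)"
  defines "e \<equiv> \<lambda>s. E_pert l V q j t W s j"
  shows "has_fourier_series (M_plus l V q j t \<sigma> A W)
    (\<lambda>m. v m + complex_of_real (\<sigma> * (cmod A)\<^sup>2) * correlation e e m)"
proof -
  have e: "l1_bounded e U"
    unfolding e_def by (rule E_pert_bound(2)[OF Z])
  have "u_plus l V q j t A W x = A * cis (t \<bullet> x) * (\<Sum>\<^sub>\<infinity>s. e s * cis (lat s \<bullet> x))" for x
  proof -
    have "u_plus l V q j t A W x = A * (\<Sum>\<^sub>\<infinity>s. e s * cis (P s t \<bullet> x))"
      by (simp add: u_plus_def e_def)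
    also have "(\<Sum>\<^sub>\<infinity>s. e s * cis (P s t \<bullet> x)) = (\<Sum>\<^sub>\<infinity>s. cis (t \<bullet> x) * (e s * cis (lat s \<bullet> x)))"
      by (simp add: P_def inner_add_left mult_ac flip: cis_mult)
    finally show ?thesis
      by (simp only: infsum_cmult_right' mult.assoc)
  qed
  then have eq: "M_plus l V q j t \<sigma> A W =
      (\<lambda>x. V x + \<sigma> * (cmod A)\<^sup>2 * (cmod (\<Sum>\<^sub>\<infinity>s. e s * cis (lat s \<bullet> x)))\<^sup>2)"
    by (simp add: fun_eq_iff M_plus_def norm_mult power_mult_distrib)
  show ?thesis
    unfolding eq
    by (rule has_fourier_series_add[OF V has_fourier_series_cmult[OF has_fourier_series_norm_square[OF e]]])
qed

end

subsection \<open>The iteration\<close>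

text \<open>\<open>small\<close> gives ratio \<open>1/4\<close> for every potential within
  \<open>\<tau> * U\<^sup>2\<close> of \<open>V\<close>. \<open>contraction\<close> asks for
  \<open>1/2\<close> instead of 1 because the tail of the geometric series has to stay below twice
  its first term.\<close>

locale resonant_iteration = resonant_point +
  fixes \<sigma> :: real and A :: complex
  assumes amplitude: "\<bar>\<sigma>\<bar> * (cmod A)\<^sup>2 \<le> \<tau>"
    and small: "C\<^sub>R * (\<tau> * U\<^sup>2 + \<tau> * K) \<le> 1 / 4"
    and contraction: "(U\<^sup>2 + 2 * U * L) * \<tau> < 1 / 2"
begin

text \<open>One number for two purposes: \<open>U\<^sup>2 * \<tau>\<close> is the size of the first
  step, \<open>2 * U * L * \<tau>\<close> the Lipschitz constant of the map.\<close>

abbreviation "\<theta> \<equiv> (U\<^sup>2 + 2 * U * L) * \<tau>"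

text \<open>A ball about \<open>V\<close> that the map sends into itself: inside it the column bound
  \<open>U\<close> is the same for all \<open>W\<close>, so the autocorrelation has norm at most
  \<open>U\<^sup>2\<close> and the amplitude supplies \<open>\<tau>\<close>.\<close>

definition admissible :: "(real ^ 'a \<Rightarrow> real) \<Rightarrow> bool" where
  "admissible W \<longleftrightarrow> has_fourier_series W (fourier_coeff W) \<and>
     l1_bounded (\<lambda>m. fourier_coeff W m - v m) (\<tau> * U\<^sup>2)"

lemma U_pos: "0 < U"
  using d_pos C\<^sub>R_pos by (simp add: column_const_def add_pos_pos)

lemma L_nonneg: "0 \<le> L"
  using d_pos by (simp add: lipschitz_const_def)

lemma admissible_V: "admissible V"
  using V \<tau> by (simp add: admissible_def l1_bounded_zero)

lemma admissible_col_bounded: "admissible W \<Longrightarrow> col_bounded \<Gamma> (scaled_step W) (1 / 4)"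
  unfolding admissible_def using col_bounded_scaled_step small col_bounded_le by blast

abbreviation "M \<equiv> M_plus l V q j t \<sigma> A"

lemma fourier_coeff_M:
  assumes "admissible W"
  shows "fourier_coeff (M W) m = v m + complex_of_real (\<sigma> * (cmod A)\<^sup>2) *
    correlation (\<lambda>s. E_pert l V q j t W s j) (\<lambda>s. E_pert l V q j t W s j) m"
  by (rule has_fourier_series_fourier_coeff[OF M_plus_fourier_series[OF admissible_col_bounded[OF assms]]])

lemma l1_bounded_amplitude:
  assumes "l1_bounded f C"
  shows "l1_bounded (\<lambda>m. complex_of_real (\<sigma> * (cmod A)\<^sup>2) * f m) (\<tau> * C)"
proof (rule l1_bounded_le[OF l1_bounded_cmult[OF assms]])
  have "norm (complex_of_real (\<sigma> * (cmod A)\<^sup>2)) \<le> \<tau>"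
    using amplitude by (simp add: norm_mult abs_mult norm_power)
  then show "norm (complex_of_real (\<sigma> * (cmod A)\<^sup>2)) * C \<le> \<tau> * C"
    by (rule mult_right_mono) (rule l1_bounded_nonneg[OF assms])
qed

lemma admissible_M:
  assumes W: "admissible W"
  shows "admissible (M W)"
proof -
  note e = E_pert_bound(2)[OF admissible_col_bounded[OF W], of j]
  have "has_fourier_series (M W) (fourier_coeff (M W))"
    using M_plus_fourier_series[OF admissible_col_bounded[OF W]] has_fourier_series_unique by metis
  moreover have "l1_bounded (\<lambda>m. fourier_coeff (M W) m - v m) (\<tau> * U\<^sup>2)"
    using l1_bounded_amplitude[OF l1_bounded_correlation[OF e e]]
    by (simp add: fourier_coeff_M[OF W] power2_eq_square)
  ultimately show ?thesis by (simp add: admissible_def)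
qed

lemma M_contraction:
  assumes W: "admissible W" "admissible W'"
    and \<rho>: "l1_bounded (\<lambda>m. fourier_coeff W m - fourier_coeff W' m) \<rho>"
  shows "l1_bounded (\<lambda>m. fourier_coeff (M W) m - fourier_coeff (M W') m) (\<theta> * \<rho>)"
proof -
  let ?e = "\<lambda>s. E_pert l V q j t W s j" and ?e' = "\<lambda>s. E_pert l V q j t W' s j"
  note e = E_pert_bound(2)[OF admissible_col_bounded[OF W(1)], of j]
    and e' = E_pert_bound(2)[OF admissible_col_bounded[OF W(2)], of j]
  have D: "l1_bounded (\<lambda>s. ?e s - ?e' s) (L * \<rho>)"
    using W \<rho> by (intro E_pert_diff_bound admissible_col_bounded) (auto simp: admissible_def)
  have "l1_bounded (\<lambda>m. correlation ?e ?e m - correlation ?e' ?e' m) (L * \<rho> * U + U * (L * \<rho>))"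
    unfolding correlation_diff[OF e e']
    by (intro l1_bounded_add l1_bounded_correlation D e e')
  from l1_bounded_amplitude[OF this]
  have "l1_bounded (\<lambda>m. fourier_coeff (M W) m - fourier_coeff (M W') m)
      (\<tau> * (L * \<rho> * U + U * (L * \<rho>)))"
    by (simp add: fourier_coeff_M W right_diff_distrib)
  moreover have "\<tau> * (L * \<rho> * U + U * (L * \<rho>)) \<le> \<theta> * \<rho>"
    using \<tau> l1_bounded_nonneg[OF \<rho>] by (simp add: algebra_simps)
  ultimately show ?thesis by (rule l1_bounded_le)
qed

abbreviation "Wseq \<equiv> W_plus l V q j t \<sigma> A"

lemma W_plus_Suc: "Wseq (Suc i) = M (Wseq i)"
  by (simp add: W_plus_def)

lemma admissible_W_plus: "admissible (Wseq i)"
  by (induction i) (simp_all add: W_plus_Suc admissible_M, simp add: W_plus_def admissible_V)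

lemma W_plus_fourier_series: "has_fourier_series (Wseq i) (fourier_coeff (Wseq i))"
  using admissible_W_plus by (simp add: admissible_def)

text \<open>The first step already has size \<open>\<theta>\<close>, and each application of the map
  gains one more factor; hence the exponent \<open>i + 1\<close>.\<close>

lemma W_plus_step:
  "l1_bounded (\<lambda>m. fourier_coeff (Wseq (Suc i)) m - fourier_coeff (Wseq i) m) (\<theta> ^ (i + 1))"
proof (induction i)
  case 0
  have "\<tau> * U\<^sup>2 \<le> \<theta>"
    using \<tau> U_pos L_nonneg by (simp add: algebra_simps)
  moreover have "Wseq 0 = V" by (simp add: W_plus_def)
  ultimately show ?case
    using admissible_W_plus[of "Suc 0"] by (auto simp: admissible_def intro: l1_bounded_le)
next
  case (Suc i)
  from M_contraction[OF admissible_W_plus admissible_W_plus Suc] show ?case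
    by (simp add: W_plus_Suc[of "Suc i"] W_plus_Suc[of i])
qed

lemma W_plus_converges:
  "star_potential (Wseq i) \<and> expansion_converges l V q j t (Wseq i)"
  "\<exists>Wp. continuous_on UNIV Wp \<and> periodic Wp \<and> star_norm Wp < \<infinity> \<and>
     (\<lambda>i. star_norm (\<lambda>x. Wseq i x - Wp x)) \<longlonglongrightarrow> 0 \<and>
     (\<forall>i. star_norm (\<lambda>x. Wp x - Wseq i x) < ennreal (2 * \<theta> ^ (i + 1)))"
proof -
  show "star_potential (Wseq i) \<and> expansion_converges l V q j t (Wseq i)" for i
    using has_fourier_series_star_potential[OF W_plus_fourier_series]
      expansion_converges_scaled_step[OF admissible_col_bounded[OF admissible_W_plus]] by blast
  let ?\<epsilon> = "\<lambda>i. \<theta> ^ (i + 1) / (1 - \<theta>)"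
  \<comment> \<open>Positivity of \<open>\<theta>\<close> is what makes the strict inequality in the
    error bound possible.\<close>
  have \<theta>: "0 < \<theta>" "\<theta> < 1 / 2"
    using \<tau> U_pos L_nonneg contraction by (auto intro!: mult_pos_pos add_pos_nonneg)
  then obtain w' where w': "\<And>i. l1_bounded (\<lambda>m. w' m - fourier_coeff (Wseq i) m) (?\<epsilon> i)"
    using l1_geometric_limit[of "\<lambda>i. fourier_coeff (Wseq i)" \<theta>, OF W_plus_step] by auto
  have \<epsilon>: "?\<epsilon> \<longlonglongrightarrow> 0"
  proof -
    have "(\<lambda>i. \<theta> ^ i) \<longlonglongrightarrow> 0"
      using \<theta> by (intro LIMSEQ_realpow_zero) auto
    from tendsto_mult_right_zero[OF this, of "\<theta> / (1 - \<theta>)"] show ?thesis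
      by (simp add: mult_ac)
  qed
  define Wp where "Wp x = Re (\<Sum>\<^sub>\<infinity>m. w' m * cis (lat m \<bullet> x))" for x
  have Wp: "has_fourier_series Wp w'"
    unfolding Wp_def[abs_def] by (rule has_fourier_series_limit[OF W_plus_fourier_series w' \<epsilon>])
  have "star_norm (\<lambda>x. Wp x - Wseq i x) < ennreal (2 * \<theta> ^ (i + 1))" for i
  proof -
    have "star_norm (\<lambda>x. Wp x - Wseq i x) \<le> ennreal (?\<epsilon> i)"
      by (rule has_fourier_series_star_norm_le[OF has_fourier_series_diff[OF Wp W_plus_fourier_series] w'])
    also have "\<dots> < ennreal (2 * \<theta> ^ (i + 1))"
    proof (rule ennreal_lessI)
      have y: "0 < \<theta> ^ (i + 1)" using \<theta> by simp
      then show "0 < 2 * \<theta> ^ (i + 1)" by simp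
      \<comment> \<open>Summing the tail costs \<open>1 / (1 - \<theta>)\<close>, strictly less than
        the factor 2 in the claim.\<close>
      have "y / (1 - s) < 2 * y" if "0 < y" "s < 1 / 2" for y s :: real
        using mult_strict_left_mono[of 1 "2 - 2 * s" y] that
        by (simp add: pos_divide_less_eq algebra_simps)
      from this[OF y \<theta>(2)] show "?\<epsilon> i < 2 * \<theta> ^ (i + 1)" .
    qed
    finally show ?thesis .
  qed
  moreover have "(\<lambda>i. star_norm (\<lambda>x. Wseq i x - Wp x)) \<longlonglongrightarrow> 0"
  proof (rule tendsto_sandwich)
    show "(\<lambda>_. 0 :: ennreal) \<longlonglongrightarrow> 0" by simp
    show "(\<lambda>i. ennreal (?\<epsilon> i)) \<longlonglongrightarrow> 0"
      using tendsto_ennrealI[OF \<epsilon>] by simp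
    have "l1_bounded (\<lambda>m. fourier_coeff (Wseq i) m - w' m) (?\<epsilon> i)" for i
      using l1_bounded_uminus[OF w'[of i]] by simp
    from has_fourier_series_star_norm_le[OF has_fourier_series_diff[OF W_plus_fourier_series Wp] this]
    show "\<forall>\<^sub>F i in sequentially. star_norm (\<lambda>x. Wseq i x - Wp x) \<le> ennreal (?\<epsilon> i)"
      by simp
  qed simp
  moreover have "star_norm Wp < \<infinity>"
    using has_fourier_series_star_potential[OF Wp] by (simp add: star_potential_def)
  ultimately show "\<exists>Wp. continuous_on UNIV Wp \<and> periodic Wp \<and> star_norm Wp < \<infinity> \<and>
     (\<lambda>i. star_norm (\<lambda>x. Wseq i x - Wp x)) \<longlonglongrightarrow> 0 \<and>
     (\<forall>i. star_norm (\<lambda>x. Wp x - Wseq i x) < ennreal (2 * \<theta> ^ (i + 1)))"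
    using has_fourier_series_continuous[OF Wp] has_fourier_series_periodic[OF Wp] by blast
qed

end

text \<open>Cutting the coefficients off outside \<open>S\<close> gives a Fourier series of
  \<open>V\<close>; uniqueness then shows that the cut-off changed nothing, so the coefficients
  outside \<open>S\<close> vanish.\<close>

lemma trig_polynomial_fourier_series:
  assumes "trig_polynomial R0 V" "\<exists>x. V x \<noteq> 0"
  obtains S where "finite S" "0 \<notin> S" "\<And>m. m \<notin> S \<Longrightarrow> fourier_coeff V m = 0"
    "has_fourier_series V (fourier_coeff V)"
proof -
  define S where "S = {m. 0 < norm (lat m :: real ^ 'a) \<and> norm (lat m :: real ^ 'a) \<le> R0}"
  define c where "c m = (if m \<in> S then fourier_coeff V m else 0)" for m
  have V: "complex_of_real (V x) = (\<Sum>m\<in>S. fourier_coeff V m * cis (lat m \<bullet> x))" for x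
    using assms(1) by (simp add: trig_polynomial_def S_def)
  \<comment> \<open>No lattice points are counted: a sum over an infinite set is 0 by convention,
    and \<open>V\<close> would vanish identically.\<close>
  have S: "finite S"
    using assms(2) V by (metis of_real_eq_0_iff sum.infinite)
  have "l1_bounded c (\<Sum>m\<in>S. norm (c m))"
    by (rule l1_bounded_finite_support[OF S]) (auto simp: c_def)
  moreover have "complex_of_real (V x) = (\<Sum>\<^sub>\<infinity>m. c m * cis (lat m \<bullet> x))" for x
  proof -
    have "(\<Sum>\<^sub>\<infinity>m. c m * cis (lat m \<bullet> x)) = (\<Sum>m\<in>S. c m * cis (lat m \<bullet> x))"
      by (rule infsum_finite_support[OF S]) (simp add: c_def)
    then show ?thesis by (simp add: V c_def)
  qed
  ultimately have c: "has_fourier_series V c"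
    by (simp add: has_fourier_series_def l1_bounded_summable)
  then have "fourier_coeff V = c"
    by (rule has_fourier_series_unique)
  moreover have "0 \<notin> S" by (simp add: S_def)
  ultimately show thesis
    using S c by (intro that[of S]) (auto simp: c_def)
qed

theorem corollary17:
  fixes l :: nat and R0 :: real and V :: "real ^ 'n \<Rightarrow> real" and q :: "int ^ 'n"
  assumes "0 < l" and "CARD('n) < 2 * l"
    and "trig_polynomial R0 V" and "\<exists>x. V x \<noteq> 0"
    and "q \<noteq> 0" and "fourier_coeff V q \<noteq> 0"
  shows "\<exists>c>0. \<forall>X. resonant_family l V q X \<longrightarrow>
    (\<forall>\<gamma>2>0. \<forall>\<delta>. 0 < 8 * \<delta> \<and> 8 * \<delta> < 2 * real l - real CARD('n) \<longrightarrow>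
      (let \<gamma>1 = (2 * real l - real CARD('n) - 8 * \<delta>) / 2; \<gamma> = min \<gamma>1 \<gamma>2 in
       \<exists>k0>0. \<forall>k>k0. \<forall>\<sigma>. \<forall>t\<in>X k \<delta>. \<forall>j. resonant_index q k \<delta> t j \<longrightarrow>
         (\<forall>A. \<bar>\<sigma>\<bar> * (cmod A)\<^sup>2 < k powr (- \<gamma>2) \<longrightarrow>
           (\<forall>m. star_potential (W_plus l V q j t \<sigma> A m) \<and>
                expansion_converges l V q j t (W_plus l V q j t \<sigma> A m)) \<and>
           (\<exists>Wp. continuous_on UNIV Wp \<and> periodic Wp \<and> star_norm Wp < \<infinity> \<and>
              (\<lambda>m. star_norm (\<lambda>x. W_plus l V q j t \<sigma> A m x - Wp x)) \<longlonglongrightarrow> 0 \<and>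
              (\<forall>m. star_norm (\<lambda>x. Wp x - W_plus l V q j t \<sigma> A m x)
                     < ennreal (2 * (c * k powr (- \<gamma>)) ^ (m + 1)))))))"
proof -
  obtain S where S: "finite S" "0 \<notin> S" "\<And>m. m \<notin> S \<Longrightarrow> fourier_coeff V m = 0"
    and V: "has_fourier_series V (fourier_coeff V)"
    using trig_polynomial_fourier_series[OF assms(3,4)] by blast
  define K where "K = (\<Sum>m\<in>S. norm (fourier_coeff V m))"
  have K: "l1_bounded (fourier_coeff V) K"
    unfolding K_def by (rule l1_bounded_finite_support[OF S(1,3)]) auto
  define U L R where "U = column_const V q" and "L = lipschitz_const V q" and "R = resolvent_const V q"
  \<comment> \<open>The coefficient of \<open>\<tau>\<close> in \<open>\<theta>\<close>. It depends
    on \<open>V\<close> and \<open>q\<close> alone and is fixed before \<open>X\<close>,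
    \<open>\<gamma>2\<close> and \<open>\<delta>\<close>.\<close>
  define c where "c = U\<^sup>2 + 2 * U * L"
  have d: "0 < contour_radius V q"
    using assms(6) by (simp add: contour_radius_def)
  then have R: "0 < R"
    by (simp add: R_def resolvent_const_def add_pos_pos)
  then have U: "0 < U" and L: "0 \<le> L"
    using d by (simp_all add: U_def L_def R_def column_const_def lipschitz_const_def add_pos_pos)
  then have c: "0 < c"
    by (simp add: c_def add_pos_nonneg)
  show ?thesis
  proof (intro exI[of _ c] conjI c allI impI)
    fix X :: "real \<Rightarrow> real \<Rightarrow> (real ^ 'n) set" and \<gamma>2 \<delta> :: real
    assume X: "resonant_family l V q X" and \<gamma>2: "0 < \<gamma>2"
      and \<delta>: "0 < 8 * \<delta> \<and> 8 * \<delta> < 2 * real l - real CARD('n)"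
    define \<gamma>1 where "\<gamma>1 = (2 * real l - real CARD('n) - 8 * \<delta>) / 2"
    define \<gamma> where "\<gamma> = min \<gamma>1 \<gamma>2"
    have "0 < \<gamma>1" using \<delta> by (simp add: \<gamma>1_def)
    then have \<gamma>: "0 < \<gamma>" "\<gamma> \<le> \<gamma>1" "\<gamma> \<le> \<gamma>2"
      using \<gamma>2 by (auto simp: \<gamma>_def)
    let ?gap = "\<lambda>k t j. \<forall>z\<in>sphere (complex_of_real (lambda_plus l V q j t)) (contour_radius V q).
      \<forall>m. m \<noteq> j \<and> m \<noteq> j - q \<longrightarrow>
        k powr (2 * real l - real CARD('n) - 6 * \<delta>) \<le> 2 * cmod (complex_of_real (p m t ^ (2 * l)) - z)"
    have "\<forall>\<^sub>F k in at_top. \<forall>t0\<in>X k \<delta>. \<forall>j. resonant_index q k \<delta> t0 j \<longrightarrow>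
        (\<forall>t. dist t t0 < 2 * k powr (- real CARD('n) + 1 - 7 * \<delta>) \<longrightarrow> ?gap k t j)"
      using X \<delta> unfolding resonant_family_def by (auto elim!: allE[of _ \<delta>] eventually_mono)
    \<comment> \<open>The gap holds on a neighbourhood of \<open>X k \<delta>\<close>; here it is
      used at the centre \<open>t = t0\<close>, at distance 0.\<close>
    then have ev1: "\<forall>\<^sub>F k in at_top. \<forall>t\<in>X k \<delta>. \<forall>j. resonant_index q k \<delta> t j \<longrightarrow> ?gap k t j"
      using eventually_gt_at_top[of 0] by eventually_elim auto
    \<comment> \<open>The first bound yields the hypothesis \<open>small\<close>, the second
      \<open>contraction\<close>.\<close>
    define \<epsilon> where "\<epsilon> = min (1 / (4 * R * (U\<^sup>2 + K + 1))) (1 / (2 * c))"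
    have K0: "0 \<le> K" using l1_bounded_nonneg[OF K] .
    have \<epsilon>: "0 < \<epsilon>"
      using R K0 c by (simp add: \<epsilon>_def add_nonneg_pos)
    have "((\<lambda>k. k powr (- \<gamma>)) \<longlongrightarrow> 0) at_top"
      using \<gamma>(1) by (intro tendsto_neg_powr filterlim_ident) auto
    then have ev2: "\<forall>\<^sub>F k in at_top. k powr (- \<gamma>) < \<epsilon>"
      using \<epsilon> by (rule order_tendstoD)
    obtain k1 where *: "\<forall>k>k1. (\<forall>t\<in>X k \<delta>. \<forall>j. resonant_index q k \<delta> t j \<longrightarrow> ?gap k t j) \<and>
        k powr (- \<gamma>) < \<epsilon>"
      using eventually_conj[OF ev1 ev2] unfolding eventually_at_top_dense by (elim exE)
    then have k1: "\<And>k t j. k1 < k \<Longrightarrow> t \<in> X k \<delta> \<Longrightarrow> resonant_index q k \<delta> t j \<Longrightarrow> ?gap k t j"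
      by metis
    have k1': "\<And>k. k1 < k \<Longrightarrow> k powr (- \<gamma>) < \<epsilon>"
      using * by blast
    show "let \<gamma>1 = (2 * real l - real CARD('n) - 8 * \<delta>) / 2; \<gamma> = min \<gamma>1 \<gamma>2 in
       \<exists>k0>0. \<forall>k>k0. \<forall>\<sigma>. \<forall>t\<in>X k \<delta>. \<forall>j. resonant_index q k \<delta> t j \<longrightarrow>
         (\<forall>A. \<bar>\<sigma>\<bar> * (cmod A)\<^sup>2 < k powr (- \<gamma>2) \<longrightarrow>
           (\<forall>m. star_potential (W_plus l V q j t \<sigma> A m) \<and>
                expansion_converges l V q j t (W_plus l V q j t \<sigma> A m)) \<and>
           (\<exists>Wp. continuous_on UNIV Wp \<and> periodic Wp \<and> star_norm Wp < \<infinity> \<and>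
              (\<lambda>m. star_norm (\<lambda>x. W_plus l V q j t \<sigma> A m x - Wp x)) \<longlonglongrightarrow> 0 \<and>
              (\<forall>m. star_norm (\<lambda>x. Wp x - W_plus l V q j t \<sigma> A m x)
                     < ennreal (2 * (c * k powr (- \<gamma>)) ^ (m + 1)))))"
      unfolding Let_def \<gamma>1_def[symmetric] \<gamma>_def[symmetric]
    \<comment> \<open>With \<open>k > 1\<close>, powers of \<open>k\<close> are monotone in the
      exponent.\<close>
    proof (rule exI[of _ "max 1 k1"], rule conjI, simp, intro allI ballI impI)
      fix k \<sigma> :: real and t :: "real ^ 'n" and j :: "int ^ 'n" and A :: complex
      assume k: "max 1 k1 < k" and t: "t \<in> X k \<delta>" and j: "resonant_index q k \<delta> t j"
        and A: "\<bar>\<sigma>\<bar> * (cmod A)\<^sup>2 < k powr (- \<gamma>2)"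
      define \<tau> where "\<tau> = k powr (- \<gamma>)"
      have \<tau>: "0 < \<tau>" "\<tau> < \<epsilon>"
        using k k1' by (simp_all add: \<tau>_def)
      have "k powr (- \<gamma>) \<le> k powr 0"
        using k \<gamma> by (intro powr_mono) auto
      then have \<tau>1: "\<tau> \<le> 1" using k by (simp add: \<tau>_def)
      interpret resonant_iteration l V q j t \<tau> K \<sigma> A
      proof
        fix z m
        assume z: "z \<in> sphere (complex_of_real (lambda_plus l V q j t)) (contour_radius V q)"
          and m: "m \<noteq> j" "m \<noteq> j - q"
        \<comment> \<open>As
          \<open>2 * \<gamma> \<le> 2 * \<gamma>1 = 2 * l - n - 8 * \<delta>\<close>, the exponent
          is at least \<open>2 * \<delta>\<close>.\<close>
        have "1 \<le> k powr (2 * real l - real CARD('n) - 6 * \<delta> - 2 * \<gamma>)"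
          using k \<gamma> \<delta> by (intro ge_one_powr_ge_zero) (auto simp: \<gamma>1_def)
        also have "\<dots> = \<tau>\<^sup>2 * k powr (2 * real l - real CARD('n) - 6 * \<delta>)"
          using k by (simp add: \<tau>_def power2_eq_square flip: powr_add)
        also have "\<dots> \<le> \<tau>\<^sup>2 * (2 * cmod (complex_of_real (p m t ^ (2 * l)) - z))"
          using k1[OF _ t j] k z m by (intro mult_left_mono) auto
        finally show "1 \<le> 2 * \<tau>\<^sup>2 * cmod (complex_of_real (p m t ^ (2 * l)) - z)"
          by (simp add: mult_ac)
      next
        have "k powr (- \<gamma>2) \<le> \<tau>"
          unfolding \<tau>_def using k \<gamma> by (intro powr_mono) auto
        then show "\<bar>\<sigma>\<bar> * (cmod A)\<^sup>2 \<le> \<tau>" using A by simp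
      next
        have pos: "0 < 4 * R * (U\<^sup>2 + K + 1)"
          using R K0 by (simp add: add_nonneg_pos)
        have "\<tau> < 1 / (4 * R * (U\<^sup>2 + K + 1))"
          using \<tau>(2) by (simp add: \<epsilon>_def)
        then have "\<tau> * (4 * R * (U\<^sup>2 + K + 1)) < 1"
          using pos by (simp only: pos_less_divide_eq)
        moreover have "4 * (R * (\<tau> * U\<^sup>2 + \<tau> * K)) \<le> \<tau> * (4 * R * (U\<^sup>2 + K + 1))"
          using R \<tau>(1) by (simp add: algebra_simps)
        ultimately show "resolvent_const V q * (\<tau> * (column_const V q)\<^sup>2 + \<tau> * K) \<le> 1 / 4"
          unfolding R_def U_def by linarith
      next
        have "\<tau> < 1 / (2 * c)"
          using \<tau>(2) by (simp add: \<epsilon>_def)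
        then show "((column_const V q)\<^sup>2 + 2 * column_const V q * lipschitz_const V q) * \<tau> < 1 / 2"
          using c unfolding c_def U_def L_def by (simp add: field_simps)
      qed (use V K S \<tau> \<tau>1 assms in auto)
      show "(\<forall>m. star_potential (W_plus l V q j t \<sigma> A m) \<and>
                expansion_converges l V q j t (W_plus l V q j t \<sigma> A m)) \<and>
           (\<exists>Wp. continuous_on UNIV Wp \<and> periodic Wp \<and> star_norm Wp < \<infinity> \<and>
              (\<lambda>m. star_norm (\<lambda>x. W_plus l V q j t \<sigma> A m x - Wp x)) \<longlonglongrightarrow> 0 \<and>
              (\<forall>m. star_norm (\<lambda>x. Wp x - W_plus l V q j t \<sigma> A m x)
                     < ennreal (2 * (c * k powr (- \<gamma>)) ^ (m + 1))))"
        using W_plus_converges unfolding c_def U_def L_def \<tau>_def[symmetric] by blast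
    qed
  qed
qed

end
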